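(* If the polynomial $P_n^{\mathcal{B}}(x_{ij},y_{ij},z_i)$ is a reduced form of $w_{C_n}=x_{12}x_{23}\cdots x_{n-1,n}z_n$, then up to commutations $$P_n^{\mathcal{B}}(x_{ij},y_{ij},z_i)=\sum_{T^l}m^{\mathcal{B}}[T^l],$$ where the sum runs over all alternating well-structured graphs $T^l$ on the vertex set $[n]$ with lexicographic edge-labels.
   Context: Signed graphs: a signed graph on $[n]=\{1,\dots,n\}$ is a finite multigraph (loops allowed) with each edge labeled $+$ or $-$; all loops are labeled $+$. An edge with endpoints $i,j$ and sign $\epsilon$ is written $(i,j,\epsilon)=(j,i,\epsilon)$. A positive edge is incident with a positive sign to both endpoints; a negative edge is incident with a positive sign to its smaller endpoint and with a negative sign to its larger one. A graph is alternating if at every vertex all incident edges are incident with the same sign. A graph $H$ on $[n]$ is well-structured if: (i) $H$ is noncrossing, i.e. there are no $i<j<k<l$ with edges $(i,k,\epsilon_1),(j,l,\epsilon_2)$ of $H$; (ii) for any edges $(i,j,+),(k,l,+)$ with $i<j$, $k<l$: $i<l$ and $k<j$; (iii) for any edges $(i,i,+),(k,l,+)$ with $k<l$: $k\le i\le l$; (iv) there are no edges $(i,i,+),(k,j,-)$ with $k<i<j$; (v) there are no edges $(i,j,+),(k,l,-)$ with $k\le i<j\le l$; (vi) $H$ is connected, contains exactly one loop, and contains no nonloop cycles. Lexicographic order on edges (each written with first index $\le$ second index): any positive edge is less than any negative edge; among edges of the same sign, $(i_1,j_1,\epsilon)$ is less than $(i_2,j_2,\epsilon)$ if $j_1>j_2$,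 or $j_1=j_2$ and $i_1>i_2$. Edge-labels $1,\dots,m$ are lexicographic if lexicographically smaller edges have smaller labels. For an edge-labeled graph $G$ with edges labeled $1,\dots,p$, $m^{\mathcal{B}}[G]=\mathrm{w}_1\cdots\mathrm{w}_p$ is the noncommutative monomial in which $\mathrm{w}_a$ is $x_{ij}$, $y_{ij}$ or $z_i$ according as the edge labeled $a$ is $(i,j,-)$, $(i,j,+)$ with $i<j$, or $(i,i,+)$. Reduced forms: work with noncommutative polynomials over $\mathbb{Q}$ in $x_{ij},y_{ij}$ $(1\le i<j\le n)$, $z_k$ $(k\in[n])$, modulo the commutations saying that two variables with disjoint index sets commute ("up to commutations" means equality modulo these). Reduction rules (applied to two adjacent letters of a monomial, possibly after commutations; for $i<j<k$ in (5)–(8'), $i<j$ in (9),(9')): (5) $x_{ij}x_{jk}\to x_{ik}x_{ij}+x_{jk}x_{ik}$; (5') $x_{jk}x_{ij}\to x_{ij}x_{ik}+x_{ik}x_{jk}$; (6) $x_{ij}y_{jk}\to y_{ik}x_{ij}+y_{jk}y_{ik}$; (6') $y_{jk}x_{ij}\to x_{ij}y_{ik}+y_{ik}y_{jk}$; (7) $x_{ik}y_{jk}\to y_{jk}y_{ij}+y_{ij}x_{ik}$; (7') $y_{jk}x_{ik}\to y_{ij}y_{jk}+x_{ik}y_{ij}$; (8) $y_{ik}x_{jk}\to x_{jk}y_{ij}+y_{ij}y_{ik}$; (8') $x_{jk}y_{ik}\to y_{ij}x_{jk}+y_{ik}y_{ij}$; (9) $x_{ij}z_j\to z_ix_{ij}+y_{ij}z_i+z_jy_{ij}$;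 (9') $z_jx_{ij}\to x_{ij}z_i+z_iy_{ij}+y_{ij}z_j$. A reduced form of a monomial is a polynomial obtained from it by successively applying these rules to monomials of the current polynomial, in any order, until no rule can be applied (even after commutations). *)

theory Defs
  imports Complex_Main "HOL-Library.Multiset" "HOL-Library.Poly_Mapping"
begin

datatype sign = Pos | Neg

text \<open>
  An edge is stored with its smaller endpoint first, which implements the identification of
  \<open>(i, j, s)\<close> with \<open>(j, i, s)\<close>. A graph is the multiset of its edges; the vertex set \<open>{1..n}\<close> is
  passed separately. An edge-labeled graph with labels \<open>1, \<dots>, p\<close> is the list of its edges in
  the order of their labels.
\<close>

type_synonym edge = "nat \<times> nat \<times> sign"

definition signed_graph :: "nat \<Rightarrow> edge multiset \<Rightarrow> bool" where
  "signed_graph n H \<longleftrightarrow>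
     (\<forall>i j s. (i, j, s) \<in># H \<longrightarrow> 1 \<le> i \<and> i \<le> j \<and> j \<le> n \<and> (i = j \<longrightarrow> s = Pos))"

fun incident :: "edge \<Rightarrow> nat \<Rightarrow> bool" where
  "incident (i, j, s) v \<longleftrightarrow> v = i \<or> v = j"

text \<open>Meaningful only if \<open>v\<close> is an endpoint of the edge.\<close>

fun incidence_sign :: "edge \<Rightarrow> nat \<Rightarrow> sign" where
  "incidence_sign (i, j, s) v = (if s = Neg \<and> v = j then Neg else Pos)"

definition alternating :: "edge multiset \<Rightarrow> bool" where
  "alternating H \<longleftrightarrow>
     (\<forall>v e f. e \<in># H \<and> f \<in># H \<and> incident e v \<and> incident f v
        \<longrightarrow> incidence_sign e v = incidence_sign f v)"

fun joins :: "edge \<Rightarrow> nat \<Rightarrow> nat \<Rightarrow> bool" where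
  "joins (i, j, s) u v \<longleftrightarrow> (u = i \<and> v = j) \<or> (u = j \<and> v = i)"

definition adjacent :: "edge multiset \<Rightarrow> nat \<Rightarrow> nat \<Rightarrow> bool" where
  "adjacent H u v \<longleftrightarrow> (\<exists>e. e \<in># H \<and> joins e u v)"

definition connected_graph :: "nat \<Rightarrow> edge multiset \<Rightarrow> bool" where
  "connected_graph n H \<longleftrightarrow> (\<forall>u\<in>{1..n}. \<forall>v\<in>{1..n}. (adjacent H)\<^sup>*\<^sup>* u v)"

definition is_loop :: "edge \<Rightarrow> bool" where
  "is_loop e \<longleftrightarrow> fst e = fst (snd e)"

text \<open>
  Cycles through at least two vertices. Two parallel edges form a cycle; the requirement
  \<open>mset es \<subseteq># H\<close> prevents a single edge from being traversed back and forth.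
\<close>

definition nonloop_cycle :: "edge multiset \<Rightarrow> nat list \<Rightarrow> edge list \<Rightarrow> bool" where
  "nonloop_cycle H vs es \<longleftrightarrow>
     2 \<le> length vs \<and> distinct vs \<and> length es = length vs \<and> mset es \<subseteq># H \<and>
     (\<forall>a < length vs. joins (es ! a) (vs ! a) (vs ! (Suc a mod length vs)))"

definition noncrossing :: "edge multiset \<Rightarrow> bool" where
  "noncrossing H \<longleftrightarrow>
     \<not> (\<exists>i j k l s t. i < j \<and> j < k \<and> k < l \<and> (i, k, s) \<in># H \<and> (j, l, t) \<in># H)"

definition well_structured :: "nat \<Rightarrow> edge multiset \<Rightarrow> bool" where
  "well_structured n H \<longleftrightarrow>
     noncrossing H \<and>
     (\<forall>i j k l. (i, j, Pos) \<in># H \<and> (k, l, Pos) \<in># H \<and> i < j \<and> k < l \<longrightarrow> i < l \<and> k < j) \<and>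
     (\<forall>i k l. (i, i, Pos) \<in># H \<and> (k, l, Pos) \<in># H \<and> k < l \<longrightarrow> k \<le> i \<and> i \<le> l) \<and>
     \<not> (\<exists>i j k. (i, i, Pos) \<in># H \<and> (k, j, Neg) \<in># H \<and> k < i \<and> i < j) \<and>
     \<not> (\<exists>i j k l. (i, j, Pos) \<in># H \<and> (k, l, Neg) \<in># H \<and> k \<le> i \<and> i < j \<and> j \<le> l) \<and>
     connected_graph n H \<and>
     size (filter_mset is_loop H) = 1 \<and>
     \<not> (\<exists>vs es. nonloop_cycle H vs es)"

fun lex_less :: "edge \<Rightarrow> edge \<Rightarrow> bool" where
  "lex_less (i1, j1, s1) (i2, j2, s2) \<longleftrightarrow>
     (s1 = Pos \<and> s2 = Neg) \<or> (s1 = s2 \<and> (j1 > j2 \<or> (j1 = j2 \<and> i1 > i2)))"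

definition lexicographic :: "edge list \<Rightarrow> bool" where
  "lexicographic T \<longleftrightarrow>
     (\<forall>a < length T. \<forall>b < length T. lex_less (T ! a) (T ! b) \<longrightarrow> a < b)"

text \<open>\<open>X i j\<close>, \<open>Y i j\<close> and \<open>Z i\<close> are the variables $x_{ij}$, $y_{ij}$ (used for \<open>i < j\<close>) and $z_i$.\<close>

datatype ncvar = X nat nat | Y nat nat | Z nat

fun indices :: "ncvar \<Rightarrow> nat set" where
  "indices (X i j) = {i, j}"
| "indices (Y i j) = {i, j}"
| "indices (Z i) = {i}"

inductive commute_step :: "ncvar list \<Rightarrow> ncvar list \<Rightarrow> bool" where
  "indices a \<inter> indices b = {} \<Longrightarrow> commute_step (u @ [a, b] @ v) (u @ [b, a] @ v)"

lemma commute_step_append: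
  assumes "commute_step u v"
  shows "commute_step (p @ u @ q) (p @ v @ q)"
  using assms
proof cases
  case (1 a b u' v')
  then show ?thesis
    using commute_step.intros[of a b "p @ u'" "v' @ q"] by simp
qed

lemma equivclp_commute_append:
  assumes "equivclp commute_step u v"
  shows "equivclp commute_step (p @ u @ q) (p @ v @ q)"
  using assms
proof (induction rule: equivclp_induct)
  case base
  show ?case by (rule equivclp_refl)
next
  case (step y z)
  have "commute_step (p @ y @ q) (p @ z @ q) \<or> commute_step (p @ z @ q) (p @ y @ q)"
    using step.hyps commute_step_append by blast
  with step.IH show ?case by (rule equivclp_into_equivclp)
qed

text \<open>
  Monomials modulo commutations. They form a monoid under concatenation, written additively
  because \<open>'a \<Rightarrow>\<^sub>0 'b\<close> is the monoid algebra of an additive monoid \<open>'a\<close>. The algebra \<open>ncpoly\<close> is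
  thus the free algebra over the rationals modulo the commutation relations.
\<close>

quotient_type monomial = "ncvar list" / "equivclp commute_step"
  by (rule equivp_evquivclp)

instantiation monomial :: monoid_add
begin

lift_definition zero_monomial :: monomial is "[]" .

lift_definition plus_monomial :: "monomial \<Rightarrow> monomial \<Rightarrow> monomial" is "(@)"
proof -
  fix u u' v v'
  assume u: "equivclp commute_step u u'" and v: "equivclp commute_step v v'"
  have "equivclp commute_step (u @ v) (u' @ v)"
    using equivclp_commute_append[OF u, of "[]" v] by simp
  moreover have "equivclp commute_step (u' @ v) (u' @ v')"
    using equivclp_commute_append[OF v, of u' "[]"] by simp
  ultimately show "equivclp commute_step (u @ v) (u' @ v')"
    by (rule equivclp_trans)
qed

instance
  by standard (transfer, simp)+

end

lift_definition word :: "ncvar list \<Rightarrow> monomial" is "\<lambda>u. u" .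

type_synonym ncpoly = "monomial \<Rightarrow>\<^sub>0 rat"

definition mono_poly :: "ncvar list \<Rightarrow> ncpoly" where
  "mono_poly u = Poly_Mapping.single (word u) 1"

inductive reduction_rule :: "monomial \<Rightarrow> ncpoly \<Rightarrow> bool" where
  R5: "i < j \<Longrightarrow> j < k \<Longrightarrow> reduction_rule (word [X i j, X j k])
         (mono_poly [X i k, X i j] + mono_poly [X j k, X i k])"
| R5': "i < j \<Longrightarrow> j < k \<Longrightarrow> reduction_rule (word [X j k, X i j])
         (mono_poly [X i j, X i k] + mono_poly [X i k, X j k])"
| R6: "i < j \<Longrightarrow> j < k \<Longrightarrow> reduction_rule (word [X i j, Y j k])
         (mono_poly [Y i k, X i j] + mono_poly [Y j k, Y i k])"
| R6': "i < j \<Longrightarrow> j < k \<Longrightarrow> reduction_rule (word [Y j k, X i j])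
         (mono_poly [X i j, Y i k] + mono_poly [Y i k, Y j k])"
| R7: "i < j \<Longrightarrow> j < k \<Longrightarrow> reduction_rule (word [X i k, Y j k])
         (mono_poly [Y j k, Y i j] + mono_poly [Y i j, X i k])"
| R7': "i < j \<Longrightarrow> j < k \<Longrightarrow> reduction_rule (word [Y j k, X i k])
         (mono_poly [Y i j, Y j k] + mono_poly [X i k, Y i j])"
| R8: "i < j \<Longrightarrow> j < k \<Longrightarrow> reduction_rule (word [Y i k, X j k])
         (mono_poly [X j k, Y i j] + mono_poly [Y i j, Y i k])"
| R8': "i < j \<Longrightarrow> j < k \<Longrightarrow> reduction_rule (word [X j k, Y i k])
         (mono_poly [Y i j, X j k] + mono_poly [Y i k, Y i j])"
| R9: "i < j \<Longrightarrow> reduction_rule (word [X i j, Z j])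
         (mono_poly [Z i, X i j] + mono_poly [Y i j, Z i] + mono_poly [Z j, Y i j])"
| R9': "i < j \<Longrightarrow> reduction_rule (word [Z j, X i j])
         (mono_poly [X i j, Z i] + mono_poly [Z i, Y i j] + mono_poly [Y i j, Z j])"

text \<open>
  The monomial \<open>u + l + v\<close> is a product (see above). Since monomials are taken modulo commutations, the factor \<open>l\<close> may become
  adjacent only after commutations.
\<close>

inductive reduces :: "ncpoly \<Rightarrow> ncpoly \<Rightarrow> bool" where
  "reduction_rule l r \<Longrightarrow> u + l + v \<in> Poly_Mapping.keys p \<Longrightarrow>
   c = Poly_Mapping.lookup p (u + l + v) \<Longrightarrow>
   reduces p (p - Poly_Mapping.single (u + l + v) c
                + Poly_Mapping.single u c * r * Poly_Mapping.single v 1)"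

definition reduced_form :: "ncpoly \<Rightarrow> monomial \<Rightarrow> bool" where
  "reduced_form P w \<longleftrightarrow>
     reduces\<^sup>*\<^sup>* (Poly_Mapping.single w 1) P \<and> \<not> (\<exists>Q. reduces P Q)"

definition w_C :: "nat \<Rightarrow> monomial" where
  "w_C n = word (map (\<lambda>i. X i (Suc i)) [1..<n] @ [Z n])"

fun edge_var :: "edge \<Rightarrow> ncvar" where
  "edge_var (i, j, Neg) = X i j"
| "edge_var (i, j, Pos) = (if i = j then Z i else Y i j)"

definition m_B :: "edge list \<Rightarrow> ncpoly" where
  "m_B G = mono_poly (map edge_var G)"

end

theory Submission
  imports Defs
begin

text \<open>
  Attach to $x_{ij}, y_{ij}, z_i$ the vectors $e_i - e_j$, $e_i + e_j$, $2 e_i$. A reduction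
  replaces a monomial by monomials whose cones dissect its cone, so for a point in general position
  the sum of the coefficients of the monomials whose open cone contains the point is invariant under
  reduction; it equals 1 for $w_{C_n}$ at every generic nonnegative combination of the vectors.
  The open cones of distinct alternating well-structured graphs are disjoint: the negative edges
  match each negative vertex with the nearest supply to its left, the positive edges are nested
  around the loop, and both matchings are determined by the point. Hence each such graph has
  coefficient 1, provided that no other monomials occur. The latter holds because the noncommutativity
  controls, for every two letters of a monomial derived from $w_{C_n}$, their relative position and
  order; this relation is preserved by the rules, and an irreducible monomial obeying it comes from
  an alternating well-structured graph.
\<close>

section \<open>Letters and edges\<close>

text \<open>Irreducibility is a statement about adjacent letters, alternation one about all pairs of
  letters at a vertex. Two letters with opposite signs at a vertex may be separated by letters that
  commute with neither. The bridge is that the graph of a reachable monomial is a tree plus a loop: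
  the letters in between then split into those that can be moved to the left of the pair and those
  that can be moved to its right, so that a rule applies after all. Genericity means lying outside
  the span of any fewer than \<open>n\<close> of the vectors. This keeps a point off all walls at
  once. It also makes the valuation at \<open>w_C n\<close> equal to 1 at the chosen point of any
  cone: the simple-root coordinates of the point are nonnegative, and none of them can vanish.
  Disjointness of the cones is a statement about two sets of weights for one point. It is proved by
  an exchange argument at the two ends of an edge with excess weight, by induction on increasing
  length for negative edges and then on decreasing length for positive ones.\<close>

definition letters :: "nat \<Rightarrow> ncvar set" where
  "letters n = {a. case a of X i j \<Rightarrow> 1 \<le> i \<and> i < j \<and> j \<le> n
     | Y i j \<Rightarrow> 1 \<le> i \<and> i < j \<and> j \<le> n | Z i \<Rightarrow> 1 \<le> i \<and> i \<le> n}"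

lemma letters_simps [simp]:
  "X i j \<in> letters n \<longleftrightarrow> 1 \<le> i \<and> i < j \<and> j \<le> n"
  "Y i j \<in> letters n \<longleftrightarrow> 1 \<le> i \<and> i < j \<and> j \<le> n"
  "Z i \<in> letters n \<longleftrightarrow> 1 \<le> i \<and> i \<le> n"
  by (auto simp: letters_def)

lemma finite_letters: "finite (letters n)"
proof (rule finite_subset)
  show "letters n \<subseteq> (\<lambda>(i, j). X i j) ` ({1..n} \<times> {1..n}) \<union>
          (\<lambda>(i, j). Y i j) ` ({1..n} \<times> {1..n}) \<union> Z ` {1..n}"
  proof
    fix a assume "a \<in> letters n"
    then show "a \<in> (\<lambda>(i, j). X i j) ` ({1..n} \<times> {1..n}) \<union>
          (\<lambda>(i, j). Y i j) ` ({1..n} \<times> {1..n}) \<union> Z ` {1..n}"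
      by (cases a) (auto simp: image_iff)
  qed
qed auto

fun var_edge :: "ncvar \<Rightarrow> edge" where
  "var_edge (X i j) = (i, j, Neg)"
| "var_edge (Y i j) = (i, j, Pos)"
| "var_edge (Z i) = (i, i, Pos)"

lemma edge_var_var_edge: "a \<in> letters n \<Longrightarrow> edge_var (var_edge a) = a"
  by (cases a) auto

lemma var_edge_edge_var:
  assumes "signed_graph n H" "e \<in># H"
  shows "var_edge (edge_var e) = e" and "edge_var e \<in> letters n"
proof -
  obtain i j s where e: "e = (i, j, s)" by (cases e)
  have "1 \<le> i \<and> i \<le> j \<and> j \<le> n \<and> (i = j \<longrightarrow> s = Pos)"
    using assms unfolding e signed_graph_def by blast
  then show "var_edge (edge_var e) = e" and "edge_var e \<in> letters n"
    unfolding e by (cases s; auto)+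
qed

section \<open>The order of letters in reachable monomials\<close>

text \<open>
  \<open>precedes a b\<close> lists the relative positions in which \<open>a\<close> can occur to the left of \<open>b\<close> in a
  monomial obtained from $w_{C_n}$. If the letters share an index, only one order is possible.
\<close>

fun precedes :: "ncvar \<Rightarrow> ncvar \<Rightarrow> bool" where
  "precedes (X i j) (X k l) \<longleftrightarrow> j \<le> k \<or> l < i \<or> (i \<le> k \<and> l < j) \<or> (k < i \<and> j \<le> l)"
| "precedes (X i j) (Y k l) \<longleftrightarrow> j \<le> k \<or> l < i \<or> (k < i \<and> j \<le> l)"
| "precedes (Y i j) (X k l) \<longleftrightarrow> j \<le> k \<or> l < i \<or> (i \<le> k \<and> l < j)"
| "precedes (Y i j) (Y k l) \<longleftrightarrow> (i \<le> k \<and> l < j) \<or> (k < i \<and> j \<le> l)"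
| "precedes (X i j) (Z k) \<longleftrightarrow> j \<le> k \<or> k < i"
| "precedes (Z k) (X i j) \<longleftrightarrow> k \<le> i \<or> j < k"
| "precedes (Y i j) (Z k) \<longleftrightarrow> i \<le> k \<and> k < j"
| "precedes (Z k) (Y i j) \<longleftrightarrow> i < k \<and> k \<le> j"
| "precedes (Z k) (Z l) \<longleftrightarrow> False"

lemma precedes_irrefl: "a \<in> letters n \<Longrightarrow> \<not> precedes a a"
  by (cases a) auto

text \<open>Makes sortedness under \<open>precedes\<close> invariant under commutations, so that it
  is a property of monomials and not only of words.\<close>

lemma precedes_disjoint_sym:
  "\<lbrakk>precedes a b; indices a \<inter> indices b = {}; a \<in> letters n; b \<in> letters n\<rbrakk> \<Longrightarrow> precedes b a"
  by (cases a; cases b) auto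

text \<open>The rules (5), (6), (8') replace \<open>e f\<close> by \<open>g e + f g\<close>.\<close>

inductive merge :: "ncvar \<Rightarrow> ncvar \<Rightarrow> ncvar \<Rightarrow> bool" where
  "i < j \<Longrightarrow> j < k \<Longrightarrow> merge (X i j) (X j k) (X i k)"
| "i < j \<Longrightarrow> j < k \<Longrightarrow> merge (X i j) (Y j k) (Y i k)"
| "i < j \<Longrightarrow> j < k \<Longrightarrow> merge (X j k) (Y i k) (Y i j)"

text \<open>The last two facts suffice for the remaining letters of a word: \<open>e\<close> and
  \<open>f\<close> are adjacent when they are replaced, so any other letter stands to the left of
  both or to the right of both.\<close>

lemma precedes_merge:
  assumes "merge e f g"
  shows "precedes g e" and "precedes f g"
    and "h \<in> letters n \<Longrightarrow> precedes h e \<Longrightarrow> precedes h f \<Longrightarrow> precedes h g"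
    and "h \<in> letters n \<Longrightarrow> precedes e h \<Longrightarrow> precedes f h \<Longrightarrow> precedes g h"
proof -
  show "precedes g e" using assms by cases auto
  show "precedes f g" using assms by cases auto
  show "h \<in> letters n \<Longrightarrow> precedes h e \<Longrightarrow> precedes h f \<Longrightarrow> precedes h g"
    using assms by cases (cases h; auto)+
  show "h \<in> letters n \<Longrightarrow> precedes e h \<Longrightarrow> precedes f h \<Longrightarrow> precedes g h"
    using assms by cases (cases h; auto)+
qed

lemma precedes_loop:
  assumes "i < j" "h \<in> letters n"
  shows "precedes h (X i j) \<Longrightarrow> precedes h (Z j) \<Longrightarrow> precedes h (Z i) \<and> precedes h (Y i j)"
    and "precedes (X i j) h \<Longrightarrow> precedes (Z j) h \<Longrightarrow> precedes (Z i) h \<and> precedes (Y i j) h"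
  using assms by (cases h; auto; fail)+

text \<open>The left sides of (5'), (6'), (7), (7'), (8) and (9') are out of order for
  \<open>precedes\<close>; the case \<open>bad\<close> collects them and contradicts
  sortedness.\<close>

lemma reduction_rule_cases:
  assumes "reduction_rule l r"
  obtains (merge) e f g where "merge e f g" "l = word [e, f]"
      "r = mono_poly [g, e] + mono_poly [f, g]"
  | (loop) i j where "i < j" "l = word [X i j, Z j]"
      "r = mono_poly [Z i, X i j] + mono_poly [Y i j, Z i] + mono_poly [Z j, Y i j]"
  | (bad) e f where "l = word [e, f]" "\<not> precedes e f"
proof -
  show ?thesis using assms
  proof cases
    case R5 then show ?thesis by (intro that(1)[OF merge.intros(1)])
  next
    case R6 then show ?thesis by (intro that(1)[OF merge.intros(2)])
  next
    case R8' then show ?thesis by (intro that(1)[OF merge.intros(3)])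
  next
    case R9 then show ?thesis by (intro that(2))
  next
    case (R5' i j k) then show ?thesis using that(3)[of "X j k" "X i j"] by simp
  next
    case (R6' i j k) then show ?thesis using that(3)[of "Y j k" "X i j"] by simp
  next
    case (R7 i j k) then show ?thesis using that(3)[of "X i k" "Y j k"] by simp
  next
    case (R7' i j k) then show ?thesis using that(3)[of "Y j k" "X i k"] by simp
  next
    case (R8 i j k) then show ?thesis using that(3)[of "Y i k" "X j k"] by simp
  next
    case (R9' i j) then show ?thesis using that(3)[of "Z j" "X i j"] by simp
  qed
qed

definition clash :: "nat \<Rightarrow> ncvar \<Rightarrow> ncvar \<Rightarrow> bool" where
  "clash v a b \<longleftrightarrow> v \<in> indices a \<and> v \<in> indices b \<and>
     incidence_sign (var_edge a) v \<noteq> incidence_sign (var_edge b) v"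

text \<open>One of the two letters is negative at \<open>v\<close>, hence of the form
  \<open>X u v\<close>. The positions that \<open>precedes\<close> leaves for the other one are
  exactly those in the left sides of (5), (6), (8') and (9).\<close>

lemma clash_reducible:
  assumes "clash v e f" "precedes e f" "e \<in> letters n" "f \<in> letters n"
  shows "\<exists>r. reduction_rule (word [e, f]) r"
  using assms
  by (cases e; cases f)
     (auto simp: clash_def split: if_splits
       intro: reduction_rule.intros)

section \<open>Spanning graphs and roots\<close>

definition linked :: "ncvar set \<Rightarrow> nat \<Rightarrow> nat \<Rightarrow> bool" where
  "linked A u v \<longleftrightarrow> (\<exists>a\<in>A. indices a = {u, v})"

definition spanning :: "nat \<Rightarrow> ncvar set \<Rightarrow> bool" where
  "spanning n A \<longleftrightarrow> (\<forall>u\<in>{1..n}. \<forall>v\<in>{1..n}. (linked A)\<^sup>*\<^sup>* u v)"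

lemma linked_rtranclp_sym: "(linked A)\<^sup>*\<^sup>* u v \<Longrightarrow> (linked A)\<^sup>*\<^sup>* v u"
proof -
  have "symp (linked A)" by (auto simp: symp_def linked_def insert_commute)
  then show "(linked A)\<^sup>*\<^sup>* u v \<Longrightarrow> (linked A)\<^sup>*\<^sup>* v u"
    by (meson symp_rtranclp sympD)
qed

lemma linked_rtranclp_mono: "(linked A)\<^sup>*\<^sup>* u v \<Longrightarrow> A \<subseteq> B \<Longrightarrow> (linked B)\<^sup>*\<^sup>* u v"
  by (erule rtranclp_mono[THEN predicate2D, rotated]) (fastforce simp: linked_def)

lemma linked_edge: "a \<in> A \<Longrightarrow> indices a = {u, v} \<Longrightarrow> (linked A)\<^sup>*\<^sup>* u v"
  by (rule r_into_rtranclp) (auto simp: linked_def)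

lemma spanning_mono:
  assumes "spanning n A"
    and "\<And>a u v. a \<in> A \<Longrightarrow> a \<notin> B \<Longrightarrow> indices a = {u, v} \<Longrightarrow> (linked B)\<^sup>*\<^sup>* u v"
  shows "spanning n B"
proof -
  have "(linked B)\<^sup>*\<^sup>* u v" if "linked A u v" for u v
    using that assms(2) linked_edge unfolding linked_def by blast
  then have "linked A \<le> (linked B)\<^sup>*\<^sup>*" by blast
  then have "(linked A)\<^sup>*\<^sup>* \<le> (linked B)\<^sup>*\<^sup>*"
    by (metis rtranclp_mono rtranclp_idemp)
  then show ?thesis using assms(1) unfolding spanning_def by blast
qed

text \<open>
  Vectors are represented as linear forms in a dual vector \<open>l\<close>.
\<close>

fun edge_form :: "ncvar \<Rightarrow> (nat \<Rightarrow> real) \<Rightarrow> real" where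
  "edge_form (X i j) l = l i - l j"
| "edge_form (Y i j) l = l i + l j"
| "edge_form (Z i) l = 2 * l i"

definition comb :: "ncvar set \<Rightarrow> (ncvar \<Rightarrow> real) \<Rightarrow> (nat \<Rightarrow> real) \<Rightarrow> real" where
  "comb A w = (\<lambda>l. \<Sum>a\<in>A. w a * edge_form a l)"

lemma edge_form_linear: "edge_form a (\<lambda>k. x * l k + y * m k) = x * edge_form a l + y * edge_form a m"
  by (cases a) (auto simp: algebra_simps)

text \<open>The dimension count behind both tree sizes and generic points: fewer equations than
  unknowns leave a nonzero solution. Each equation is paid for with one unknown
  \<open>k\<close>.\<close>

lemma annihilator:
  assumes "finite S" "finite K" "card S < card K"
  shows "\<exists>l. (\<exists>k\<in>K. l k \<noteq> 0) \<and> (\<forall>k. k \<notin> K \<longrightarrow> l k = 0) \<and> (\<forall>a\<in>S. edge_form a l = 0)"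
  using assms
proof (induction S arbitrary: K rule: finite_induct)
  case empty
  then obtain k where "k \<in> K" by fastforce
  then show ?case by (intro exI[of _ "\<lambda>i. of_bool (i = k)"]) auto
next
  case (insert s S)
  then obtain l where l: "\<exists>k\<in>K. l k \<noteq> 0" "\<forall>k. k \<notin> K \<longrightarrow> l k = 0" "\<forall>a\<in>S. edge_form a l = 0"
    by (metis card_insert_disjoint Suc_lessD)
  then obtain k where k: "k \<in> K" "l k \<noteq> 0" by blast
  have "card S < card (K - {k})" using insert k by simp
  then obtain m where m: "\<exists>i\<in>K - {k}. m i \<noteq> 0" "\<forall>i. i \<notin> K - {k} \<longrightarrow> m i = 0"
      "\<forall>a\<in>S. edge_form a m = 0"
    using insert.IH[of "K - {k}"] insert.prems by blast
  show ?case
  proof (cases "edge_form s m = 0")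
    case True
    then show ?thesis using m by (intro exI[of _ m]) auto
  next
    case False
    \<comment> \<open>The coefficients cancel at \<open>s\<close>, and the coordinate
      \<open>k\<close> of \<open>h\<close> survives because \<open>m\<close> vanishes there.\<close>
    define h where "h = (\<lambda>i. edge_form s m * l i + (- edge_form s l) * m i)"
    have edge_form: "edge_form a h = edge_form s m * edge_form a l + (- edge_form s l) * edge_form a m" for a
      unfolding h_def by (rule edge_form_linear)
    have "h k \<noteq> 0" using False k m(2) by (simp add: h_def)
    moreover have "\<forall>i. i \<notin> K \<longrightarrow> h i = 0" using l(2) m(2) by (simp add: h_def)
    moreover have "\<forall>a\<in>insert s S. edge_form a h = 0" using l(3) m(3) by (auto simp: edge_form)
    ultimately show ?thesis using k(1) by blast
  qed
qed

text \<open>The loop forces \<open>l i = 0\<close>. Every edge carries this to its other end, since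
  its form gives \<open>l u = l v\<close> or \<open>l u = - l v\<close>.\<close>

lemma spanning_annihilator:
  assumes "spanning n A" "Z i \<in> A" "A \<subseteq> letters n" "\<forall>a\<in>A. edge_form a l = 0" "k \<in> {1..n}"
  shows "l k = 0"
proof -
  have "i \<in> {1..n}" using assms(2,3) by auto
  then have "(linked A)\<^sup>*\<^sup>* i k" using assms(1,5) unfolding spanning_def by blast
  then show ?thesis
  proof induction
    case base
    show ?case using assms(2,4) by force
  next
    case (step u v)
    then obtain a where a: "a \<in> A" "indices a = {u, v}" unfolding linked_def by blast
    then have "edge_form a l = 0" using assms(4) by blast
    with a(2) step.IH show ?case by (cases a) (auto simp: doubleton_eq_iff)
  qed
qed

lemma spanning_card:
  assumes "spanning n A" "Z i \<in> A" "A \<subseteq> letters n"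
  shows "n \<le> card A"
proof (rule ccontr)
  assume "\<not> n \<le> card A"
  then obtain l where "\<exists>k\<in>{1..n}. l k \<noteq> 0" "\<forall>a\<in>A. edge_form a l = 0"
    using annihilator[of A "{1..n}"] finite_subset[OF assms(3) finite_letters] by auto
  then show False using spanning_annihilator assms by blast
qed

text \<open>Spanning with \<open>n\<close> letters including a loop means tree plus loop: no edge can be spared.\<close>

lemma spanning_no_cycle:
  assumes "spanning n A" "Z i \<in> A" "A \<subseteq> letters n" "card A = n"
    and "e \<in> A" "indices e = {u, v}" "u \<noteq> v"
  shows "\<not> (linked (A - {e}))\<^sup>*\<^sup>* u v"
proof
  assume uv: "(linked (A - {e}))\<^sup>*\<^sup>* u v"
  have "spanning n (A - {e})"
    using assms(1)
  proof (rule spanning_mono)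
    fix a x y assume "a \<in> A" "a \<notin> A - {e}" "indices a = {x, y}"
    then have "{x, y} = {u, v}" using assms(6) by auto
    then show "(linked (A - {e}))\<^sup>*\<^sup>* x y"
      using uv linked_rtranclp_sym by (auto simp: doubleton_eq_iff)
  qed
  moreover have "Z i \<in> A - {e}" using assms(2,6,7) by auto
  ultimately have "n \<le> card (A - {e})" using spanning_card assms(3) by blast
  moreover have "finite A" using assms(3) finite_letters by (rule finite_subset)
  ultimately show False using assms(4,5) by (metis card_Diff1_less not_le)
qed

section \<open>Good monomials\<close>

lemma word_append: "word (u @ v) = word u + word v"
  by transfer (rule equivclp_refl)

lemma word_Cons: "word (a # u) = word [a] + word u"
  using word_append[of "[a]" u] by simp

lemma word_surj: obtains u where "m = word u"
proof -
  have "\<exists>u. m = word u" by transfer (meson equivclp_refl)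
  then show ?thesis using that by blast
qed

lemma word_eq_iff: "word u = word v \<longleftrightarrow> equivclp commute_step u v"
  by transfer simp

lemma word_swap: "indices a \<inter> indices b = {} \<Longrightarrow> word (a # b # u) = word (b # a # u)"
  unfolding word_eq_iff using commute_step.intros[of a b "[]" u] by (intro r_into_equivclp) simp

lemma word_commute_past:
  "\<forall>b\<in>set xs. indices a \<inter> indices b = {} \<Longrightarrow> word (a # xs) = word (xs @ [a])"
proof (induction xs)
  case Nil
  show ?case by simp
next
  case (Cons b xs)
  then have "word (a # b # xs) = word (b # a # xs)" by (intro word_swap) simp
  also have "\<dots> = word [b] + word (a # xs)" by (rule word_Cons)
  also have "\<dots> = word [b] + word (xs @ [a])" using Cons by simp
  finally show ?case using word_Cons[of b "xs @ [a]"] by simp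
qed

lemma word_separate:
  assumes "\<forall>a\<in>set xs. \<forall>b\<in>set xs. P a \<and> \<not> P b \<longrightarrow> indices a \<inter> indices b = {}"
  shows "word xs = word (filter (\<lambda>a. \<not> P a) xs @ filter P xs)"
  using assms
proof (induction xs)
  case Nil
  show ?case by simp
next
  case (Cons a xs)
  let ?N = "filter (\<lambda>a. \<not> P a) xs" and ?P = "filter P xs"
  have IH: "word (a # xs) = word (a # ?N @ ?P)"
    unfolding word_Cons[of a xs] word_Cons[of a "?N @ ?P"] using Cons by simp
  show ?case
  proof (cases "P a")
    case True
    then have "word (a # ?N) = word (?N @ [a])"
      using Cons.prems by (intro word_commute_past) auto
    then have "word ((a # ?N) @ ?P) = word ((?N @ [a]) @ ?P)"
      by (simp only: word_append)
    then show ?thesis using True IH by simp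
  next
    case False
    then show ?thesis using IH by simp
  qed
qed

text \<open>The invariant of reduction. Sortedness stands for conditions (i) to (v) of
  well-structured graphs; length, connectivity and the single loop stand for (vi). Alternation is
  what irreducibility adds.\<close>

definition good :: "nat \<Rightarrow> ncvar list \<Rightarrow> bool" where
  "good n U \<longleftrightarrow> set U \<subseteq> letters n \<and> length U = n \<and> sorted_wrt precedes U \<and>
     spanning n (set U) \<and> (\<exists>!i. Z i \<in> set U)"

lemma good_equivclp:
  assumes "equivclp commute_step U V"
  shows "good n U \<longleftrightarrow> good n V"
proof -
  have step: "good n V" if "commute_step U V" "good n U" for U V
    using that
  proof cases
    case (1 a b u v)
    have "precedes b a" if "good n U"
      using that 1 precedes_disjoint_sym[of a b n]
      by (auto simp: good_def sorted_wrt_append)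
    then show ?thesis
      using \<open>good n U\<close> 1 by (auto simp: good_def sorted_wrt_append insert_commute)
  qed
  have sym: "commute_step V U" if "commute_step U V" for U V
    using that by cases (metis commute_step.intros inf_commute)
  from assms show ?thesis
    by (induction rule: equivclp_induct) (use step sym in blast)+
qed

lift_definition good_monomial :: "nat \<Rightarrow> monomial \<Rightarrow> bool" is good
  by (rule good_equivclp)

lemma good_monomial_word: "good_monomial n (word U) \<longleftrightarrow> good n U"
  by transfer simp

text \<open>Commutations preserve the letters, so a monomial has a well-defined set of vectors and
  hence a cone.\<close>

lift_definition content :: "monomial \<Rightarrow> ncvar multiset" is mset
proof -
  fix U V assume "equivclp commute_step U V"
  then show "mset U = mset V"
    by (induction rule: equivclp_induct) (auto elim!: commute_step.cases)
qed

lemma content_word [simp]: "content (word U) = mset U"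
  by transfer simp

section \<open>Goodness under the rules\<close>

lemma good_distinct:
  assumes "good n U"
  shows "distinct U"
proof -
  have "set U \<subseteq> letters n" "sorted_wrt precedes U" using assms by (auto simp: good_def)
  then show ?thesis by (induction U) (use precedes_irrefl in auto)
qed

lemma merge_triangle:
  assumes "merge e f g"
  obtains a b c where "indices e = {a, b}" "indices f = {b, c}" "indices g = {a, c}"
  using assms
proof cases
  case (1 i j k) then show ?thesis using that[of i j k] by simp
next
  case (2 i j k) then show ?thesis using that[of i j k] by simp
next
  case (3 i j k) then show ?thesis using that[of j k i] by (simp add: insert_commute)
qed

lemma linked_triangle:
  assumes "a \<in> B" "b \<in> B" "indices a = {x, y}" "indices b = {y, z}" "{u, v} = {x, z}"
  shows "(linked B)\<^sup>*\<^sup>* u v"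
proof -
  have "(linked B)\<^sup>*\<^sup>* x z"
    using assms linked_edge rtranclp_trans[of "linked B" x y z] by blast
  then show ?thesis using assms(5) linked_rtranclp_sym by (auto simp: doubleton_eq_iff)
qed

text \<open>\<open>e\<close>, \<open>f\<close>, \<open>g\<close> are the sides of a triangle: the
  side that disappears is replaced by the path through the other two.\<close>

lemma good_merge:
  assumes "good n (u @ [e, f] @ v)" "merge e f g"
  shows "good n (u @ [g, e] @ v)" and "good n (u @ [f, g] @ v)"
proof -
  let ?A = "set (u @ [e, f] @ v)"
  obtain a b c where abc: "indices e = {a, b}" "indices f = {b, c}" "indices g = {a, c}"
    using assms(2) by (rule merge_triangle)
  have sub: "set (u @ [e, f] @ v) \<subseteq> letters n" and sp: "spanning n ?A"
    and sorted: "sorted_wrt precedes (u @ [e, f] @ v)"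
    using assms(1) by (auto simp: good_def)
  have g: "g \<in> letters n"
    using assms(2) sub by (cases rule: merge.cases) auto
  have nonloop: "\<And>i. Z i \<notin> {e, f, g}"
    using assms(2) by cases auto
  have "spanning n (set (u @ [g, e] @ v))"
    using sp
  proof (rule spanning_mono)
    fix h x y
    assume "h \<in> ?A" "h \<notin> set (u @ [g, e] @ v)" and h: "indices h = {x, y}"
    then have "h = f" by auto
    then show "(linked (set (u @ [g, e] @ v)))\<^sup>*\<^sup>* x y"
      using linked_triangle[of e _ g b a c x y] abc h by (auto simp: insert_commute)
  qed
  moreover have "spanning n (set (u @ [f, g] @ v))"
    using sp
  proof (rule spanning_mono)
    fix h x y
    assume "h \<in> ?A" "h \<notin> set (u @ [f, g] @ v)" and h: "indices h = {x, y}"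
    then have "h = e" by auto
    then show "(linked (set (u @ [f, g] @ v)))\<^sup>*\<^sup>* x y"
      using linked_triangle[of g _ f a c b x y] abc h by (auto simp: insert_commute)
  qed
  moreover have "precedes h g" if "h \<in> set u" for h
    using that sorted sub precedes_merge(3)[OF assms(2)] by (auto simp: sorted_wrt_append)
  moreover have "precedes g h" if "h \<in> set v" for h
    using that sorted sub precedes_merge(4)[OF assms(2)] by (auto simp: sorted_wrt_append)
  ultimately show "good n (u @ [g, e] @ v)" and "good n (u @ [f, g] @ v)"
    using assms(1) g nonloop precedes_merge(1,2)[OF assms(2)]
    by (auto simp: good_def sorted_wrt_append)
qed

lemma good_loop:
  assumes "good n (u @ [X i j, Z j] @ v)" "i < j"
  shows "good n (u @ [Z i, X i j] @ v)" and "good n (u @ [Y i j, Z i] @ v)"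
    and "good n (u @ [Z j, Y i j] @ v)"
proof -
  let ?A = "set (u @ [X i j, Z j] @ v)"
  have sub: "?A \<subseteq> letters n" and sp: "spanning n ?A" and len: "length u + length v + 2 = n"
    and sorted: "sorted_wrt precedes (u @ [X i j, Z j] @ v)" and one: "\<exists>!i. Z i \<in> ?A"
    using assms(1) by (auto simp: good_def)
  have distinct: "distinct (u @ [X i j, Z j] @ v)" using assms(1) by (rule good_distinct)
  \<comment> \<open>The one loop is the \<open>Z j\<close> that the rule consumes, so exactly one is
    left whichever loop is inserted.\<close>
  have no_Z: "Z k \<notin> set u \<union> set v" for k
  proof
    assume k: "Z k \<in> set u \<union> set v"
    then have "Z k \<in> ?A" "Z j \<in> ?A" by auto
    then have "k = j" using one by blast
    then show False using k distinct by auto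
  qed
  have spanning: "spanning n (insert a (set u \<union> set v))" if "a \<in> {X i j, Y i j}" for a
    using sp
  proof (rule spanning_mono)
    fix h x y
    assume h: "h \<in> ?A" "h \<notin> insert a (set u \<union> set v)" and xy: "indices h = {x, y}"
    show "(linked (insert a (set u \<union> set v)))\<^sup>*\<^sup>* x y"
    proof (cases "h = Z j")
      case True
      then have "x = y" using xy by auto
      then show ?thesis by simp
    next
      case False
      then have "h = X i j" using h by auto
      moreover have "indices a = indices (X i j)" using that by auto
      ultimately have "indices a = {x, y}" using xy by simp
      then show ?thesis using linked_edge by blast
    qed
  qed
  have spanning_Z: "spanning n (insert (Z k) (insert a (set u \<union> set v)))"
    if "a \<in> {X i j, Y i j}" for a k
    using spanning[OF that] by (rule spanning_mono) blast
  have "precedes h (Z i) \<and> precedes h (Y i j)" if "h \<in> set u" for h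
    using that sorted sub precedes_loop(1)[OF assms(2)] by (auto simp: sorted_wrt_append)
  moreover have "precedes (Z i) h \<and> precedes (Y i j) h" if "h \<in> set v" for h
    using that sorted sub precedes_loop(2)[OF assms(2)] by (auto simp: sorted_wrt_append)
  ultimately have sorted': "sorted_wrt precedes (u @ [a, b] @ v)"
    if "(a, b) \<in> {(Z i, X i j), (Y i j, Z i), (Z j, Y i j)}" for a b
    using that sorted assms(2) by (auto simp: sorted_wrt_append)
  have good: "good n (u @ [a, b] @ v)"
    if ab: "(a, b) \<in> {(Z i, X i j), (Y i j, Z i), (Z j, Y i j)}" for a b
  proof -
    obtain k c where kc: "{a, b} = {Z k, c}" "c \<in> {X i j, Y i j}" "k \<in> {i, j}"
      using ab by fastforce
    have set: "set (u @ [a, b] @ v) = insert (Z k) (insert c (set u \<union> set v))"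
      using kc(1) by auto
    have "\<exists>!i. Z i \<in> set (u @ [a, b] @ v)"
      unfolding set using no_Z kc(2) by auto
    moreover have "set (u @ [a, b] @ v) \<subseteq> letters n"
      unfolding set using sub kc(2,3) assms(2) by auto
    ultimately show ?thesis
      using spanning_Z[OF kc(2), of k] sorted'[OF ab] len unfolding good_def set by simp
  qed
  show "good n (u @ [Z i, X i j] @ v)" and "good n (u @ [Y i j, Z i] @ v)"
    and "good n (u @ [Z j, Y i j] @ v)"
    by (rule good; simp)+
qed

section \<open>Irreducible good monomials are alternating\<close>

text \<open>A pair with the shortest gap is taken. Symmetry of \<open>Q\<close> allows the two
  letters to be met in either order.\<close>

lemma closest_pair:
  assumes "a \<in> set U" "b \<in> set U" "Q a b" and sym: "\<And>a b. Q a b \<Longrightarrow> Q b a" and "\<not> Q a a"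
  obtains u e w f v where "U = u @ e # w @ f # v" "Q e f"
    "\<And>h. h \<in> set w \<Longrightarrow> \<not> Q e h \<and> \<not> Q h f"
proof -
  define R where "R = (\<lambda>w. \<exists>u e f v. U = u @ e # w @ f # v \<and> Q e f)"
  have "\<exists>w. R w"
  proof -
    from assms(1) obtain u v where U: "U = u @ a # v" by (meson split_list)
    from assms(2,3,5) U consider "b \<in> set u" | "b \<in> set v" by auto
    then show ?thesis
    proof cases
      case 1
      then obtain s t where "u = s @ b # t" by (meson split_list)
      then have "U = s @ b # t @ a # v" using U by simp
      then show ?thesis unfolding R_def using sym[OF assms(3)] by blast
    next
      case 2
      then obtain s t where "v = s @ b # t" by (meson split_list)
      then have "U = u @ a # s @ b # t" using U by simp
      then show ?thesis unfolding R_def using assms(3) by blast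
    qed
  qed
  then obtain w where w: "R w" and min: "\<And>w'. R w' \<Longrightarrow> length w \<le> length w'"
    by (metis arg_min_natI arg_min_nat_le)
  then obtain u e f v where U: "U = u @ e # w @ f # v" "Q e f" unfolding R_def by blast
  have "\<not> Q e h \<and> \<not> Q h f" if "h \<in> set w" for h
  proof -
    from split_list[OF that] obtain s t where st: "w = s @ h # t" by blast
    have U1: "U = u @ e # s @ h # (t @ f # v)" and U2: "U = (u @ e # s) @ h # t @ f # v"
      using U(1) st by simp_all
    have "R s" if "Q e h" unfolding R_def using U1 that by blast
    moreover have "R t" if "Q h f" unfolding R_def using U2 that by blast
    ultimately show ?thesis using min[of s] min[of t] st by fastforce
  qed
  then show ?thesis using that U by blast
qed

text \<open>A closest clashing pair \<open>e\<close>, \<open>f\<close> is brought together by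
  commutations: the word \<open>W\<close> between them is rearranged so that its left part commutes
  with \<open>e\<close> and its right part with \<open>f\<close>. Acyclicity guarantees such a
  rearrangement.\<close>

lemma good_irreducible_no_clash:
  assumes good: "good n U" and irred: "\<And>p l q r. reduction_rule l r \<Longrightarrow> word U \<noteq> p + l + q"
    and "a \<in> set U" "b \<in> set U"
  shows "\<not> clash v a b"
proof
  assume ab: "clash v a b"
  obtain U1 e W f U2 where U: "U = U1 @ e # W @ f # U2" and ef: "clash v e f"
    and W: "\<And>h. h \<in> set W \<Longrightarrow> \<not> clash v e h \<and> \<not> clash v h f"
  proof (rule closest_pair[of a U b "clash v"])
    show "clash v c d \<Longrightarrow> clash v d c" for c d by (metis clash_def)
    show "\<not> clash v a a" by (simp add: clash_def)
  qed (use assms(3,4) ab in blast)+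
  \<comment> \<open>\<open>e\<close> and \<open>f\<close> carry both signs at \<open>v\<close>, so a
    letter of \<open>W\<close> at \<open>v\<close> would clash with one of them.\<close>
  have v_W: "v \<notin> indices h" if "h \<in> set W" for h
    using W[OF that] ef by (cases "incidence_sign (var_edge h) v") (auto simp: clash_def)
  have sub: "set U \<subseteq> letters n" and sp: "spanning n (set U)" and loop: "\<exists>i. Z i \<in> set U"
    and prec: "precedes e f"
    using good U by (auto simp: good_def sorted_wrt_append)
  have distinct: "distinct U" using good by (rule good_distinct)
  then have card: "card (set U) = n" using good by (simp add: good_def distinct_card)
  have pair: "\<exists>x. indices h = {v, x}" if "v \<in> indices h" for h
    using that by (cases h) auto
  obtain x where x: "indices e = {v, x}" using pair ef by (auto simp: clash_def)
  obtain y where y: "indices f = {v, y}" using pair ef by (auto simp: clash_def)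
  \<comment> \<open>The component of the far end \<open>x\<close> of \<open>e\<close> in the graph
    of \<open>W\<close>. It is made empty when \<open>e\<close> is a loop, for then \<open>e\<close>
    commutes with all of \<open>W\<close>.\<close>
  define R where "R = {z. x \<noteq> v \<and> (linked (set W))\<^sup>*\<^sup>* x z}"
  define P where "P = (\<lambda>h. indices h \<inter> R \<noteq> {})"
  have closed: "indices h \<subseteq> R" if h: "h \<in> set W" "P h" for h
  proof
    fix s assume s: "s \<in> indices h"
    obtain t where t: "t \<in> indices h" "t \<in> R" using h(2) by (auto simp: P_def)
    have "(linked (set W))\<^sup>*\<^sup>* t s"
    proof (cases "s = t")
      case False
      then have "indices h = {t, s}" using s t(1) by (cases h) auto
      then show ?thesis using h(1) linked_edge by blast
    qed simp
    then show "s \<in> R" using t(2) by (auto simp: R_def)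
  qed
  have sepW: "word W = word (filter (\<lambda>h. \<not> P h) W @ filter P W)"
    using closed by (intro word_separate) (auto simp: P_def)
  have e_comm: "word (e # filter (\<lambda>h. \<not> P h) W) = word (filter (\<lambda>h. \<not> P h) W @ [e])"
    using v_W by (intro word_commute_past) (auto simp: x P_def R_def)
  \<comment> \<open>If the component of \<open>x\<close> reached the far end \<open>y\<close> of
    \<open>f\<close>, a path from \<open>x\<close> to \<open>y\<close> in \<open>W\<close> followed
    by \<open>f\<close> would lead to \<open>v\<close> without \<open>e\<close>, closing a
    cycle.\<close>
  have "indices f \<inter> indices h = {}" if h: "h \<in> set W" "P h" for h
  proof (rule ccontr)
    assume "indices f \<inter> indices h \<noteq> {}"
    then have "y \<in> indices h" using v_W[OF h(1)] by (auto simp: y)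
    then have "y \<in> R" using closed h by blast
    then have xv: "x \<noteq> v" and xy: "(linked (set W))\<^sup>*\<^sup>* x y" by (auto simp: R_def)
    have "e \<notin> insert f (set W)" using distinct U by auto
    then have subset: "insert f (set W) \<subseteq> set U - {e}" using U by auto
    then have "(linked (set U - {e}))\<^sup>*\<^sup>* x y"
      using linked_rtranclp_mono[OF xy] by blast
    moreover have "(linked (set U - {e}))\<^sup>*\<^sup>* y v"
      using subset y linked_edge[of f _ y v] by (auto simp: insert_commute)
    ultimately have "(linked (set U - {e}))\<^sup>*\<^sup>* x v" by (rule rtranclp_trans)
    then show False
      using spanning_no_cycle[OF sp _ sub card, of _ e x v] loop x xv U
      by (auto simp: insert_commute)
  qed
  then have f_comm: "word (f # filter P W) = word (filter P W @ [f])"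
    by (intro word_commute_past) auto
  have "word (e # W @ [f]) = word [e] + word W + word [f]"
    by (simp add: word_append[symmetric])
  also have "\<dots> = word (e # filter (\<lambda>h. \<not> P h) W) + word (filter P W @ [f])"
    unfolding sepW by (simp add: word_append[symmetric])
  also have "\<dots> = word (filter (\<lambda>h. \<not> P h) W) + word [e, f] + word (filter P W)"
    unfolding e_comm f_comm[symmetric] by (simp add: word_append[symmetric])
  finally have "word U = (word U1 + word (filter (\<lambda>h. \<not> P h) W)) + word [e, f]
      + (word (filter P W) + word U2)"
    using word_append[of U1 "(e # W @ [f]) @ U2"] word_append[of "e # W @ [f]" U2] U
    by (simp add: add.assoc)
  moreover obtain r where "reduction_rule (word [e, f]) r"
    using clash_reducible[OF ef prec, of n] sub U by fastforce
  ultimately show False using irred by blast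
qed

section \<open>Generic points of cones\<close>

text \<open>The weights are arbitrary reals: \<open>q\<close> has to avoid linear spans, which
  contain the proper faces of cones on \<open>n\<close> letters as well as the walls between
  them.\<close>

definition generic :: "nat \<Rightarrow> ((nat \<Rightarrow> real) \<Rightarrow> real) \<Rightarrow> bool" where
  "generic n q \<longleftrightarrow> (\<forall>S w. S \<subseteq> letters n \<and> card S < n \<longrightarrow> q \<noteq> comb S w)"

definition in_cone :: "((nat \<Rightarrow> real) \<Rightarrow> real) \<Rightarrow> ncvar set \<Rightarrow> bool" where
  "in_cone q A \<longleftrightarrow> (\<exists>w. (\<forall>a\<in>A. 0 < w a) \<and> q = comb A w)"

lemma comb_insert:
  "finite A \<Longrightarrow> a \<notin> A \<Longrightarrow> comb (insert a A) w l = w a * edge_form a l + comb A w l"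
  by (simp add: comb_def)

lemma comb_cong: "(\<And>a. a \<in> A \<Longrightarrow> w a = w' a) \<Longrightarrow> comb A w = comb A w'"
  by (simp add: comb_def)

lemma comb_linear: "comb A (\<lambda>a. x * w a + y * w' a) l = x * comb A w l + y * comb A w' l"
  by (simp add: comb_def sum_distrib_left sum.distrib algebra_simps)

lemma in_cone_pair:
  assumes "finite A" "a \<notin> A" "b \<notin> A" "a \<noteq> b"
  shows "in_cone q (insert a (insert b A)) \<longleftrightarrow>
    (\<exists>x y w. 0 < x \<and> 0 < y \<and> (\<forall>c\<in>A. 0 < w c) \<and>
       (\<forall>l. q l = x * edge_form a l + y * edge_form b l + comb A w l))"
    (is "?L \<longleftrightarrow> ?R")
proof
  assume ?L
  then obtain w where "\<forall>c\<in>insert a (insert b A). 0 < w c" "q = comb (insert a (insert b A)) w"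
    unfolding in_cone_def by blast
  then show ?R
    using assms by (intro exI[of _ "w a"] exI[of _ "w b"] exI[of _ w]) (simp add: comb_insert)
next
  assume ?R
  then obtain x y w where w: "0 < x" "0 < y" "\<forall>c\<in>A. 0 < w c"
    "\<And>l. q l = x * edge_form a l + y * edge_form b l + comb A w l" by blast
  let ?w = "w(a := x, b := y)"
  have "comb A ?w = comb A w" using assms(2,3) by (intro comb_cong) auto
  then have "q = comb (insert a (insert b A)) ?w"
    using assms by (intro ext) (simp add: comb_insert w(4))
  moreover have "\<forall>c\<in>insert a (insert b A). 0 < ?w c" using w by auto
  ultimately show ?L unfolding in_cone_def by blast
qed

text \<open>
  If $v_g = v_e + v_f$, the cone of \<open>e, f\<close> is cut into those of \<open>g, e\<close> and \<open>f, g\<close> by the wall on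
  which \<open>e\<close> and \<open>f\<close> have equal weights; a generic point lies on no wall.
\<close>

lemma in_cone_split:
  assumes q: "generic n q" and sub: "insert g A \<subseteq> letters n" and card: "card A + 2 = n"
    and notin: "e \<notin> A" "f \<notin> A" "g \<notin> A" and neq: "e \<noteq> f" "e \<noteq> g" "f \<noteq> g"
    and g: "\<And>l. edge_form g l = edge_form e l + edge_form f l"
  shows "of_bool (in_cone q (insert e (insert f A))) =
    (of_bool (in_cone q (insert g (insert e A))) + of_bool (in_cone q (insert f (insert g A))) :: rat)"
    (is "of_bool ?EF = of_bool ?GE + of_bool ?FG")
proof -
  have fin: "finite A" using sub finite_letters by (meson finite_subset insert_subset)
  have wall: False
    if "\<And>l. q l = x * edge_form g l + comb A w l" for x w
  proof -
    have "comb A (w(g := x)) = comb A w" using notin by (intro comb_cong) auto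
    then have "q = comb (insert g A) (w(g := x))"
      using fin notin that by (intro ext) (simp add: comb_insert)
    moreover have "card (insert g A) < n" using fin notin card by simp
    ultimately show False using q sub unfolding generic_def by blast
  qed
  note pair = in_cone_pair[OF fin]
  have "?GE \<or> ?FG" if ?EF
  proof -
    from that obtain x y w where w: "0 < x" "0 < y" "\<forall>c\<in>A. 0 < w c"
      "\<And>l. q l = x * edge_form e l + y * edge_form f l + comb A w l"
      using pair[of e f] notin neq by blast
    consider "y < x" | "x < y" | "x = y" by linarith
    then show ?thesis
    proof cases
      case 1
      have "q l = y * edge_form g l + (x - y) * edge_form e l + comb A w l" for l
        by (simp add: w(4) g algebra_simps)
      then have ?GE using pair[of g e q] notin neq w 1
        by (metis diff_gt_0_iff_gt)
      then show ?thesis ..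
    next
      case 2
      have "q l = (y - x) * edge_form f l + x * edge_form g l + comb A w l" for l
        by (simp add: w(4) g algebra_simps)
      then have ?FG using pair[of f g q] notin neq w 2
        by (metis diff_gt_0_iff_gt)
      then show ?thesis ..
    next
      case 3
      then have "q l = x * edge_form g l + comb A w l" for l
        by (simp add: w(4) g algebra_simps)
      then show ?thesis using wall by blast
    qed
  qed
  moreover have ?EF if ge: ?GE
  proof -
    from ge obtain x y w where w: "0 < x" "0 < y" "\<forall>c\<in>A. 0 < w c"
      "\<And>l. q l = x * edge_form g l + y * edge_form e l + comb A w l"
      using pair[of g e] notin neq by blast
    then have "q l = (x + y) * edge_form e l + x * edge_form f l + comb A w l" for l
      by (simp add: g algebra_simps)
    then show ?EF using pair[of e f q] notin neq w by (metis add_pos_pos)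
  qed
  moreover have ?EF if fg: ?FG
  proof -
    from fg obtain x y w where w: "0 < x" "0 < y" "\<forall>c\<in>A. 0 < w c"
      "\<And>l. q l = x * edge_form f l + y * edge_form g l + comb A w l"
      using pair[of f g] notin neq by blast
    then have "q l = y * edge_form e l + (x + y) * edge_form f l + comb A w l" for l
      by (simp add: g algebra_simps)
    then show ?EF using pair[of e f q] notin neq w by (metis add_pos_pos)
  qed
  moreover have False if ge: ?GE and fg: ?FG
  proof -
    from ge obtain x y w where w: "0 < x" "0 < y" "\<forall>c\<in>A. 0 < w c"
      "\<And>l. q l = x * edge_form g l + y * edge_form e l + comb A w l"
      using pair[of g e] notin neq by blast
    from fg obtain x' y' w' where w': "0 < x'" "0 < y'" "\<forall>c\<in>A. 0 < w' c"
      "\<And>l. q l = x' * edge_form f l + y' * edge_form g l + comb A w' l"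
      using pair[of f g] notin neq by blast
    \<comment> \<open>In the two representations \<open>e\<close> has excess \<open>y\<close> over
      \<open>f\<close>, and \<open>f\<close> has excess \<open>x'\<close> over \<open>e\<close>. The
      convex combination with weights \<open>s\<close>, \<open>t\<close> balances the excesses, so
      \<open>e\<close> and \<open>f\<close> recombine into \<open>g\<close> and \<open>q\<close>
      lies on the wall.\<close>
    define s where "s = x' / (y + x')"
    define t where "t = y / (y + x')"
    have st: "s + t = 1" "s * y = t * x'"
      using w(2) w'(1) by (simp_all add: s_def t_def add_divide_distrib[symmetric] add.commute)
    have "q l = (s * x + t * y' + s * y) * edge_form g l + comb A (\<lambda>a. s * w a + t * w' a) l" for l
    proof -
      have "q l = s * q l + t * q l" using st(1) by (metis mult_1 distrib_right)
      also have "\<dots> = s * (x * edge_form g l + y * edge_form e l + comb A w l)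
          + t * (x' * edge_form f l + y' * edge_form g l + comb A w' l)"
        using w(4) w'(4) by metis
      also have "\<dots> = (s * x + t * y') * edge_form g l + (s * y) * edge_form e l
          + (t * x') * edge_form f l + (s * comb A w l + t * comb A w' l)"
        by (simp add: algebra_simps)
      also have "\<dots> = (s * x + t * y' + s * y) * edge_form g l + (s * comb A w l + t * comb A w' l)"
        unfolding st(2)[symmetric] g by (simp add: algebra_simps)
      finally show ?thesis by (simp add: comb_linear)
    qed
    then show False by (rule wall)
  qed
  ultimately show ?thesis by (cases ?EF; cases ?GE; cases ?FG) auto
qed

section \<open>Existence of generic points\<close>

lemma avoid_hyperplanes:
  fixes G :: "('a \<Rightarrow> real) set"
  assumes "finite G" "finite A" "\<And>g. g \<in> G \<Longrightarrow> \<exists>a\<in>A. g a \<noteq> 0"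
  shows "\<exists>w. (\<forall>a\<in>A. 0 < w a) \<and> (\<forall>g\<in>G. (\<Sum>a\<in>A. w a * g a) \<noteq> 0)"
  using assms(1,3)
proof (induction G rule: finite_induct)
  case empty
  show ?case by (intro exI[of _ "\<lambda>_. 1"]) simp
next
  case (insert g G)
  then obtain w where w: "\<forall>a\<in>A. 0 < w a" "\<forall>h\<in>G. (\<Sum>a\<in>A. w a * h a) \<noteq> 0" by auto
  show ?case
  proof (cases "(\<Sum>a\<in>A. w a * g a) = 0")
    case False
    then show ?thesis using w by auto
  next
    case True
    obtain a where a: "a \<in> A" "g a \<noteq> 0" using insert.prems by blast
    \<comment> \<open>Only the weight of \<open>a\<close> is perturbed. Each old \<open>h\<close>
      with \<open>h a\<close> nonzero forbids a single value of the perturbation; if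
      \<open>h a = 0\<close>, its sum does not change.\<close>
    have "\<not> {0::real<..} \<subseteq> (\<lambda>h. - (\<Sum>a\<in>A. w a * h a) / h a) ` G"
      using insert.hyps(1) finite_subset infinite_Ioi by blast
    then obtain \<epsilon> where \<epsilon>: "0 < \<epsilon>" "\<epsilon> \<notin> (\<lambda>h. - (\<Sum>a\<in>A. w a * h a) / h a) ` G" by auto
    let ?w = "w(a := w a + \<epsilon>)"
    have sum: "(\<Sum>b\<in>A. ?w b * h b) = (\<Sum>b\<in>A. w b * h b) + \<epsilon> * h a" for h
    proof -
      have "(\<Sum>b\<in>A. ?w b * h b) = (\<Sum>b\<in>A. w b * h b + (if b = a then \<epsilon> * h a else 0))"
        by (intro sum.cong) (auto simp: algebra_simps)
      then show ?thesis using a(1) assms(2) by (simp add: sum.distrib)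
    qed
    have "(\<Sum>b\<in>A. ?w b * h b) \<noteq> 0" if "h \<in> insert g G" for h
    proof (cases "h = g")
      case True
      then show ?thesis using sum[of g] \<open>(\<Sum>a\<in>A. w a * g a) = 0\<close> a(2) \<epsilon>(1) by simp
    next
      case False
      then have h: "h \<in> G" using that by simp
      then have "\<epsilon> \<noteq> - (\<Sum>a\<in>A. w a * h a) / h a" using \<epsilon>(2) by blast
      then show ?thesis
        using w(2) h unfolding sum by (cases "h a = 0") (auto simp: field_simps)
    qed
    moreover have "\<forall>b\<in>A. 0 < ?w b" using w(1) \<epsilon>(1) by (auto intro: add_pos_pos)
    ultimately show ?thesis by blast
  qed
qed

text \<open>For every small set \<open>S\<close> a nonzero functional kills all combinations of
  \<open>S\<close>, but not all of \<open>A\<close>, because \<open>A\<close> spans. Positive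
  weights on \<open>A\<close> are then chosen so that none of these finitely many functionals
  vanishes.\<close>

lemma generic_point_exists:
  assumes "A \<subseteq> letters n" "spanning n A" "Z i \<in> A"
  shows "\<exists>q. generic n q \<and> in_cone q A"
proof -
  define \<S> where "\<S> = {S. S \<subseteq> letters n \<and> card S < n}"
  have "\<exists>l. (\<exists>k\<in>{1..n}. l k \<noteq> 0) \<and> (\<forall>a\<in>S. edge_form a l = 0)" if "S \<in> \<S>" for S
  proof -
    have "finite S" "card S < card {1..n}"
      using that finite_letters by (auto simp: \<S>_def intro: finite_subset)
    then show ?thesis using annihilator[of S "{1..n}"] by blast
  qed
  then obtain l where l: "\<And>S. S \<in> \<S> \<Longrightarrow> \<exists>k\<in>{1..n}. l S k \<noteq> 0"
    "\<And>S a. S \<in> \<S> \<Longrightarrow> a \<in> S \<Longrightarrow> edge_form a (l S) = 0"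
    by metis
  have fin: "finite A" using assms(1) finite_letters by (rule finite_subset)
  have "finite \<S>" unfolding \<S>_def using finite_letters[of n] by simp
  then have "\<exists>w. (\<forall>a\<in>A. 0 < w a) \<and>
      (\<forall>g\<in>(\<lambda>S a. edge_form a (l S)) ` \<S>. (\<Sum>a\<in>A. w a * g a) \<noteq> 0)"
    using fin
  proof (intro avoid_hyperplanes)
    fix g assume "g \<in> (\<lambda>S a. edge_form a (l S)) ` \<S>"
    then obtain S where S: "S \<in> \<S>" "g = (\<lambda>a. edge_form a (l S))" by blast
    then show "\<exists>a\<in>A. g a \<noteq> 0"
      using spanning_annihilator[OF assms(2,3,1), of "l S"] l(1)[OF S(1)] by blast
  qed auto
  then obtain w where w: "\<forall>a\<in>A. 0 < w a"
    "\<And>S. S \<in> \<S> \<Longrightarrow> (\<Sum>a\<in>A. w a * edge_form a (l S)) \<noteq> 0" by auto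
  have "generic n (comb A w)"
    unfolding generic_def
  proof (intro allI impI notI)
    fix S w' assume S: "S \<subseteq> letters n \<and> card S < n" and eq: "comb A w = comb S w'"
    then have "S \<in> \<S>" by (simp add: \<S>_def)
    moreover from this have "comb S w' (l S) = 0" using l(2) by (simp add: comb_def)
    ultimately show False using w(2) eq by (metis comb_def)
  qed
  then show ?thesis using w(1) unfolding in_cone_def by blast
qed

section \<open>The Coxeter monomial\<close>

definition coxeter_letters :: "nat \<Rightarrow> ncvar list" where
  "coxeter_letters n = map (\<lambda>i. X i (Suc i)) [1..<n] @ [Z n]"

lemma set_coxeter_letters:
  "set (coxeter_letters n) = insert (Z n) ((\<lambda>i. X i (Suc i)) ` {1..<n})"
  by (simp add: coxeter_letters_def)

lemma good_coxeter_letters: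
  assumes "1 \<le> n"
  shows "good n (coxeter_letters n)"
proof -
  let ?A = "set (coxeter_letters n)"
  have "sorted_wrt (\<lambda>i j. precedes (X i (Suc i)) (X j (Suc j))) [1..<n]"
    by (rule sorted_wrt_mono_rel[OF _ sorted_wrt_upt]) auto
  then have "sorted_wrt precedes (coxeter_letters n)"
    by (auto simp: coxeter_letters_def sorted_wrt_append sorted_wrt_map)
  moreover have from1: "(linked ?A)\<^sup>*\<^sup>* 1 v" if "1 \<le> v" "v \<le> n" for v
    using that
  proof (induction v rule: dec_induct)
    case (step v)
    then have "(linked ?A)\<^sup>*\<^sup>* v (Suc v)"
      by (intro linked_edge[of "X v (Suc v)"]) (auto simp: set_coxeter_letters)
    then show ?case using step by auto
  qed simp
  then have "spanning n ?A"
    unfolding spanning_def using linked_rtranclp_sym by (meson atLeastAtMost_iff rtranclp_trans)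
  moreover have "?A \<subseteq> letters n" using assms by (auto simp: set_coxeter_letters)
  moreover have "length (coxeter_letters n) = n" using assms by (simp add: coxeter_letters_def)
  ultimately show ?thesis
    unfolding good_def by (auto simp: set_coxeter_letters)
qed

text \<open>The letters of $w_{C_n}$ are the simple roots of type $C_n$, and every letter is a
  nonnegative combination of them.\<close>

lemma in_cone_coxeter:
  assumes n: "1 \<le> n" and q: "generic n q" "in_cone q A" and A: "A \<subseteq> letters n"
  shows "in_cone q (set (coxeter_letters n))"
proof -
  let ?C = "set (coxeter_letters n)"
  \<comment> \<open>\<open>I k\<close> is the functional that sums the first \<open>k\<close>
    coordinates. These functionals are, up to scale, dual to the simple roots and read off the
    coordinates.\<close>
  define I :: "nat \<Rightarrow> nat \<Rightarrow> real" where "I = (\<lambda>k i. of_bool (i \<le> k))"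
  obtain w where w: "\<forall>a\<in>A. 0 < w a" "q = comb A w" using q(2) unfolding in_cone_def by blast
  \<comment> \<open>The half compensates for $z_n$ standing for $2 e_n$.\<close>
  define w' where "w' = (\<lambda>a. case a of X k _ \<Rightarrow> q (I k) | _ \<Rightarrow> q (I n) / 2)"
  have telescope: "(\<Sum>k\<in>{1..<n}. I k i * (l k - l (Suc k))) + I n i * l n = l i"
    if "1 \<le> i" "i \<le> n" for i and l :: "nat \<Rightarrow> real"
  proof -
    have "(\<Sum>k\<in>{1..<n}. I k i * (l k - l (Suc k))) = (\<Sum>k\<in>{i..<n}. l k - l (Suc k))"
      using that by (intro sum.mono_neutral_cong_right) (auto simp: I_def)
    also have "\<dots> = - (\<Sum>k\<in>{i..<n}. l (Suc k) - l k)" by (simp add: sum_negf[symmetric])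
    also have "\<dots> = l i - l n" using that by (simp add: sum_Suc_diff')
    finally show ?thesis using that by (simp add: I_def)
  qed
  have expand: "edge_form a l =
      (\<Sum>k\<in>{1..<n}. edge_form a (I k) * (l k - l (Suc k))) + edge_form a (I n) * l n"
    if "a \<in> letters n" for a l
  proof (cases a)
    case (X i j)
    then show ?thesis
      using that telescope[of i l] telescope[of j l]
      by (simp add: left_diff_distrib sum_subtractf)
  next
    case (Y i j)
    then show ?thesis
      using that telescope[of i l] telescope[of j l]
      by (simp add: distrib_right sum.distrib)
  next
    case (Z i)
    then show ?thesis
      using that telescope[of i l]
      by (simp add: mult.assoc sum_distrib_left[symmetric])
  qed
  have comb_C: "comb ?C w' l = (\<Sum>k\<in>{1..<n}. q (I k) * (l k - l (Suc k))) + q (I n) * l n" for l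
  proof -
    have "inj_on (\<lambda>i. X i (Suc i)) {1..<n}" by (auto simp: inj_on_def)
    then show ?thesis
      unfolding set_coxeter_letters
      by (subst comb_insert) (auto simp: w'_def comb_def sum.reindex)
  qed
  have "q l = comb ?C w' l" for l
  proof -
    have "q l = (\<Sum>a\<in>A. w a * ((\<Sum>k\<in>{1..<n}. edge_form a (I k) * (l k - l (Suc k)))
        + edge_form a (I n) * l n))"
      unfolding w(2) comb_def using A expand by (intro sum.cong) auto
    also have "\<dots> = (\<Sum>k\<in>{1..<n}. q (I k) * (l k - l (Suc k))) + q (I n) * l n"
      unfolding w(2) comb_def distrib_left sum.distrib sum_distrib_left sum_distrib_right
      by (subst sum.swap) (simp add: mult.assoc)
    finally show ?thesis by (simp add: comb_C)
  qed
  then have qC: "q = comb ?C w'" by blast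
  have card: "card ?C = n"
    using good_coxeter_letters[OF n] good_distinct by (metis distinct_card good_def)
  have sub: "?C \<subseteq> letters n" using good_coxeter_letters[OF n] by (simp add: good_def)
  have "0 \<le> edge_form a (I k)" if "a \<in> A" for a k
    using that A by (cases a) (auto simp: I_def)
  then have "0 \<le> q (I k)" for k
    unfolding w(2) comb_def using w(1) by (intro sum_nonneg mult_nonneg_nonneg) (auto simp: less_imp_le)
  then have nonneg: "0 \<le> w' c" for c by (cases c) (auto simp: w'_def)
  \<comment> \<open>A zero coordinate would put \<open>q\<close> in the span of \<open>n - 1\<close>
    letters.\<close>
  have "0 < w' c" if "c \<in> ?C" for c
  proof (rule ccontr)
    assume "\<not> 0 < w' c"
    then have "w' c = 0" using nonneg[of c] by linarith
    then have "comb ?C w' = comb (?C - {c}) w'"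
      unfolding comb_def using that by (intro ext) (simp add: sum.remove)
    moreover have "card (?C - {c}) < n" using that card by (metis card_Diff1_less List.finite_set)
    ultimately show False using q(1) qC sub unfolding generic_def by (metis Diff_subset subset_trans)
  qed
  then show ?thesis using qC unfolding in_cone_def by blast
qed

section \<open>The valuation at a generic point\<close>

definition valuation :: "((nat \<Rightarrow> real) \<Rightarrow> real) \<Rightarrow> ncpoly \<Rightarrow> rat" where
  "valuation q p = (\<Sum>m\<in>Poly_Mapping.keys p.
     Poly_Mapping.lookup p m * of_bool (in_cone q (set_mset (content m))))"

lemma valuation_superset:
  assumes "finite K" "Poly_Mapping.keys p \<subseteq> K"
  shows "valuation q p = (\<Sum>m\<in>K. Poly_Mapping.lookup p m * of_bool (in_cone q (set_mset (content m))))"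
  unfolding valuation_def using assms by (intro sum.mono_neutral_left) (auto simp: in_keys_iff)

lemma valuation_add: "valuation q (p + r) = valuation q p + valuation q r"
proof -
  let ?K = "Poly_Mapping.keys p \<union> Poly_Mapping.keys r"
  have "Poly_Mapping.keys (p + r) \<subseteq> ?K" by (rule keys_add)
  then show ?thesis
    by (simp add: valuation_superset[of ?K] lookup_add distrib_right sum.distrib)
qed

lemma valuation_minus: "valuation q (p - r) = valuation q p - valuation q r"
  using valuation_add[of q "p - r" r] by simp

lemma valuation_single:
  "valuation q (Poly_Mapping.single m c) = c * of_bool (in_cone q (set_mset (content m)))"
  by (simp add: valuation_def)

text \<open>The two claims go together: goodness supplies the \<open>n\<close> distinct letters to
  which the cone decomposition applies.\<close>

lemma good_monomial_reduces:
  assumes "reduces p p'" "\<And>m. m \<in> Poly_Mapping.keys p \<Longrightarrow> good_monomial n m" "generic n q"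
  shows "(\<forall>m\<in>Poly_Mapping.keys p'. good_monomial n m) \<and> valuation q p' = valuation q p"
  using assms(1)
proof cases
  case (1 l r u v c)
  obtain U where U: "u = word U" by (rule word_surj)
  obtain V where V: "v = word V" by (rule word_surj)
  have in_cone_cong: "in_cone q (set_mset (content (word W))) = in_cone q (set W)" for W
    by simp
  have step: "Poly_Mapping.single u c * mono_poly W * Poly_Mapping.single v 1
      = Poly_Mapping.single (word (U @ W @ V)) c" for W
    by (simp add: mono_poly_def mult_single U V word_append add.assoc)
  have keys: "m \<in> Poly_Mapping.keys p \<or> m \<in> Poly_Mapping.keys s"
    if "m \<in> Poly_Mapping.keys (p - Poly_Mapping.single (u + l + v) c + s)" for m s
    using that 1(3) by (auto simp: in_keys_iff lookup_add lookup_minus lookup_single when_def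
        split: if_splits)
  from 1(2) show ?thesis
  proof (cases rule: reduction_rule_cases)
    case (merge e f g)
    have ulv: "u + l + v = word (U @ [e, f] @ V)"
      by (simp only: U V merge word_append add.assoc)
    then have good: "good n (U @ [e, f] @ V)"
      using assms(2) 1(3) good_monomial_word by metis
    note good' = good_merge[OF good merge(1)]
    have p': "p' = p - Poly_Mapping.single (u + l + v) c
        + (Poly_Mapping.single (word (U @ [g, e] @ V)) c + Poly_Mapping.single (word (U @ [f, g] @ V)) c)"
      unfolding 1(1) merge(3) distrib_left distrib_right step ..
    have "\<forall>m\<in>Poly_Mapping.keys p'. good_monomial n m"
    proof
      fix m assume "m \<in> Poly_Mapping.keys p'"
      from keys[OF this[unfolded p']]
      have "m \<in> Poly_Mapping.keys p \<or> m \<in> {word (U @ [g, e] @ V), word (U @ [f, g] @ V)}"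
        by (auto simp: in_keys_iff lookup_add lookup_single when_def split: if_splits)
      then show "good_monomial n m" using good' assms(2) by (auto simp: good_monomial_word)
    qed
    moreover have "of_bool (in_cone q (insert e (insert f (set U \<union> set V)))) =
      (of_bool (in_cone q (insert g (insert e (set U \<union> set V))))
       + of_bool (in_cone q (insert f (insert g (set U \<union> set V)))) :: rat)"
    proof (rule in_cone_split[OF assms(3)])
      have d: "distinct (U @ [e, f] @ V)" "distinct (U @ [g, e] @ V)" "distinct (U @ [f, g] @ V)"
        using good good' good_distinct by blast+
      show "e \<notin> set U \<union> set V" "f \<notin> set U \<union> set V" "g \<notin> set U \<union> set V" "e \<noteq> f" "e \<noteq> g" "f \<noteq> g"
        using d by auto
      show "insert g (set U \<union> set V) \<subseteq> letters n"
        using good' by (auto simp: good_def)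
      have "card (set (U @ V)) = length (U @ V)" using d(1) by (intro distinct_card) auto
      then show "card (set U \<union> set V) + 2 = n"
        using good by (simp add: good_def)
      show "edge_form g l = edge_form e l + edge_form f l" for l
        using merge(1) by cases simp_all
    qed
    ultimately show ?thesis
      unfolding p' ulv valuation_add valuation_minus valuation_single in_cone_cong
      by (simp add: distrib_left[symmetric] insert_commute)
  next
    case (loop i j)
    have ulv: "u + l + v = word (U @ [X i j, Z j] @ V)"
      by (simp only: U V loop word_append add.assoc)
    then have good: "good n (U @ [X i j, Z j] @ V)"
      using assms(2) 1(3) good_monomial_word by metis
    note good' = good_loop[OF good loop(1)]
    have p': "p' = p - Poly_Mapping.single (u + l + v) c
        + (Poly_Mapping.single (word (U @ [Z i, X i j] @ V)) c
          + Poly_Mapping.single (word (U @ [Y i j, Z i] @ V)) c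
          + Poly_Mapping.single (word (U @ [Z j, Y i j] @ V)) c)"
      unfolding 1(1) loop(3) distrib_left distrib_right step ..
    have "\<forall>m\<in>Poly_Mapping.keys p'. good_monomial n m"
    proof
      fix m assume "m \<in> Poly_Mapping.keys p'"
      from keys[OF this[unfolded p']]
      have "m \<in> Poly_Mapping.keys p \<or> m \<in> {word (U @ [Z i, X i j] @ V), word (U @ [Y i j, Z i] @ V),
          word (U @ [Z j, Y i j] @ V)}"
        by (auto simp: in_keys_iff lookup_add lookup_single when_def split: if_splits)
      then show "good_monomial n m" using good' assms(2) by (auto simp: good_monomial_word)
    qed
    moreover have "of_bool (in_cone q (insert (X i j) (insert (Z j) (set U \<union> set V)))) =
      (of_bool (in_cone q (insert (Z i) (insert (X i j) (set U \<union> set V))))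
       + of_bool (in_cone q (insert (Y i j) (insert (Z i) (set U \<union> set V))))
       + of_bool (in_cone q (insert (Z j) (insert (Y i j) (set U \<union> set V)))) :: rat)"
    proof -
      have d: "distinct (U @ [X i j, Z j] @ V)" "distinct (U @ [Z i, X i j] @ V)"
        "distinct (U @ [Y i j, Z i] @ V)"
        using good good' good_distinct by blast+
      have "card (set (U @ V)) = length (U @ V)" using d(1) by (intro distinct_card) auto
      then have card: "card (set U \<union> set V) + 2 = n"
        using good by (simp add: good_def)
      have sub: "insert (Y i j) (set U \<union> set V) \<subseteq> letters n" "insert (Z i) (set U \<union> set V) \<subseteq> letters n"
        using good' by (auto simp: good_def)
      \<comment> \<open>Rule (9) is two successive cuts: first along \<open>Y i j\<close>, the sum
        of \<open>X i j\<close> and \<open>Z j\<close>, then of the part on \<open>X i j\<close>,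
        \<open>Y i j\<close> along their sum \<open>Z i\<close>. The intermediate part has parallel
        edges and is no good monomial, so it is treated only as a cone.\<close>
      have "of_bool (in_cone q (insert (X i j) (insert (Z j) (set U \<union> set V)))) =
        (of_bool (in_cone q (insert (Y i j) (insert (X i j) (set U \<union> set V))))
         + of_bool (in_cone q (insert (Z j) (insert (Y i j) (set U \<union> set V)))) :: rat)"
        using d loop(1) by (intro in_cone_split[OF assms(3) sub(1) card]) auto
      moreover have "of_bool (in_cone q (insert (X i j) (insert (Y i j) (set U \<union> set V)))) =
        (of_bool (in_cone q (insert (Z i) (insert (X i j) (set U \<union> set V))))
         + of_bool (in_cone q (insert (Y i j) (insert (Z i) (set U \<union> set V)))) :: rat)"
        using d loop(1) by (intro in_cone_split[OF assms(3) sub(2) card]) auto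
      ultimately show ?thesis by (simp add: insert_commute)
    qed
    ultimately show ?thesis
      unfolding p' ulv valuation_add valuation_minus valuation_single in_cone_cong
      by (simp add: distrib_left[symmetric] insert_commute add.assoc)
  next
    case (bad e f)
    have "u + l + v = word (U @ [e, f] @ V)"
      by (simp only: U V bad word_append add.assoc)
    then have "good n (U @ [e, f] @ V)"
      using assms(2) 1(3) good_monomial_word by metis
    then show ?thesis using bad(2) by (auto simp: good_def sorted_wrt_append)
  qed
qed

lemma good_monomial_reduces_rtranclp:
  assumes "reduces\<^sup>*\<^sup>* p p'" "\<And>m. m \<in> Poly_Mapping.keys p \<Longrightarrow> good_monomial n m" "generic n q"
  shows "(\<forall>m\<in>Poly_Mapping.keys p'. good_monomial n m) \<and> valuation q p' = valuation q p"
  using assms(1)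
proof induction
  case base
  show ?case using assms(2) by simp
next
  case (step r s)
  then show ?case using good_monomial_reduces[OF step.hyps(2) _ assms(3)] by simp
qed

section \<open>Canonical graphs have disjoint cones\<close>

text \<open>A property of sets, without an order of the letters: comparability in either direction
  stands for (i) to (v), absence of clashes for alternation.\<close>

definition canonical :: "nat \<Rightarrow> ncvar set \<Rightarrow> bool" where
  "canonical n A \<longleftrightarrow> A \<subseteq> letters n \<and>
     (\<forall>a\<in>A. \<forall>b\<in>A. a \<noteq> b \<longrightarrow> precedes a b \<or> precedes b a) \<and>
     (\<forall>v. \<forall>a\<in>A. \<forall>b\<in>A. \<not> clash v a b)"

text \<open>Weights are extended by zero to all letters, so equality of the weight functions also
  yields equality of the two graphs.\<close>

definition same_point :: "nat \<Rightarrow> (ncvar \<Rightarrow> real) \<Rightarrow> (ncvar \<Rightarrow> real) \<Rightarrow> bool" where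
  "same_point n w w' \<longleftrightarrow> (\<forall>a. 0 \<le> w a \<and> 0 \<le> w' a) \<and>
     canonical n {a. 0 < w a} \<and> canonical n {a. 0 < w' a} \<and>
     comb (letters n) w = comb (letters n) w'"

lemma same_point_sym: "same_point n w w' \<Longrightarrow> same_point n w' w"
  by (auto simp: same_point_def)

abbreviation unit :: "nat \<Rightarrow> nat \<Rightarrow> real" where
  "unit k \<equiv> (\<lambda>i. of_bool (i = k))"

lemma edge_form_unit:
  assumes "a \<in> letters n"
  shows "k \<notin> indices a \<Longrightarrow> edge_form a (unit k) = 0"
    and "k \<in> indices a \<Longrightarrow> incidence_sign (var_edge a) k = Pos \<Longrightarrow> 0 < edge_form a (unit k)"
    and "k \<in> indices a \<Longrightarrow> incidence_sign (var_edge a) k = Neg \<Longrightarrow> edge_form a (unit k) < 0"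
proof -
  show "k \<notin> indices a \<Longrightarrow> edge_form a (unit k) = 0" by (cases a) auto
  show "k \<in> indices a \<Longrightarrow> incidence_sign (var_edge a) k = Pos \<Longrightarrow> 0 < edge_form a (unit k)"
    using assms by (cases a) (auto split: if_splits)
  show "k \<in> indices a \<Longrightarrow> incidence_sign (var_edge a) k = Neg \<Longrightarrow> edge_form a (unit k) < 0"
    using assms by (cases a) (auto split: if_splits)
qed

text \<open>By alternation nothing cancels in the \<open>k\<close>-th coordinate, so the point alone
  decides the sign of the vertex \<open>k\<close>.\<close>

lemma comb_unit_sign:
  assumes nonneg: "\<And>a. 0 \<le> w a" and w: "canonical n {a. 0 < w a}"
    and a: "0 < w a" "k \<in> indices a"
  shows "incidence_sign (var_edge a) k = Pos \<longleftrightarrow> 0 < comb (letters n) w (unit k)"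
proof -
  let ?s = "incidence_sign (var_edge a) k"
  have a_letter: "a \<in> letters n" using w a by (auto simp: canonical_def)
  have sign: "b \<in> letters n \<and> (k \<in> indices b \<longrightarrow> incidence_sign (var_edge b) k = ?s)"
    if "0 < w b" for b
    using w a that unfolding canonical_def clash_def by blast
  show ?thesis
  proof (cases ?s)
    case Pos
    have "0 \<le> w b * edge_form b (unit k)" if "b \<in> letters n" for b
    proof (cases "0 < w b \<and> k \<in> indices b")
      case True
      then show ?thesis using edge_form_unit(2)[OF that, of k] sign[of b] Pos nonneg[of b] by auto
    next
      case False
      then have "k \<notin> indices b \<or> w b = 0" using nonneg[of b] by linarith
      then show ?thesis using edge_form_unit(1)[OF that, of k] by auto
    qed
    moreover have "0 < w a * edge_form a (unit k)"
      using edge_form_unit(2)[OF a_letter a(2) Pos] a(1) by simp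
    ultimately have "0 < comb (letters n) w (unit k)"
      unfolding comb_def using a_letter finite_letters by (intro sum_pos2) auto
    then show ?thesis using Pos by simp
  next
    case Neg
    have "w b * edge_form b (unit k) \<le> 0" if "b \<in> letters n" for b
    proof (cases "0 < w b \<and> k \<in> indices b")
      case True
      then have "edge_form b (unit k) < 0" using edge_form_unit(3)[OF that, of k] sign[of b] Neg by simp
      then show ?thesis using nonneg[of b] by (simp add: mult_nonneg_nonpos)
    next
      case False
      then have "k \<notin> indices b \<or> w b = 0" using nonneg[of b] by linarith
      then show ?thesis using edge_form_unit(1)[OF that, of k] by auto
    qed
    then have "comb (letters n) w (unit k) \<le> 0"
      unfolding comb_def by (intro sum_nonpos) auto
    then show ?thesis using Neg by simp
  qed
qed

lemma same_point_sign:
  assumes "same_point n w w'" "0 < w a \<or> 0 < w' a" "0 < w b \<or> 0 < w' b"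
    "k \<in> indices a" "k \<in> indices b"
  shows "incidence_sign (var_edge a) k = incidence_sign (var_edge b) k"
proof -
  have "incidence_sign (var_edge c) k = Pos \<longleftrightarrow> 0 < comb (letters n) w (unit k)"
    if "0 < w c \<or> 0 < w' c" "k \<in> indices c" for c
    using that comb_unit_sign[of w n c k] comb_unit_sign[of w' n c k] assms(1)
    unfolding same_point_def by metis
  then have "incidence_sign (var_edge a) k = Pos \<longleftrightarrow> incidence_sign (var_edge b) k = Pos"
    using assms(2-5) by blast
  then show ?thesis
    by (cases "incidence_sign (var_edge a) k"; cases "incidence_sign (var_edge b) k") auto
qed

lemma same_point_letters:
  "same_point n w w' \<Longrightarrow> 0 < w a \<or> 0 < w' a \<Longrightarrow> a \<in> letters n"
  unfolding same_point_def canonical_def by auto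

text \<open>
  The \<open>k\<close>-th coordinates agree and all letters at \<open>k\<close> contribute to them with the same sign, so
  an excess of one weight is compensated by another letter at \<open>k\<close>.
\<close>

lemma exchange:
  assumes same: "same_point n w w'" and a: "w' a < w a" "k \<in> indices a"
  shows "\<exists>b. k \<in> indices b \<and> w b < w' b \<and>
    incidence_sign (var_edge b) k = incidence_sign (var_edge a) k"
proof (rule ccontr)
  assume "\<not> ?thesis"
  then have no: "\<not> w b < w' b"
    if "k \<in> indices b" "incidence_sign (var_edge b) k = incidence_sign (var_edge a) k" for b
    using that by blast
  have nonneg: "0 \<le> w b" "0 \<le> w' b" for b using same by (auto simp: same_point_def)
  have a_pos: "0 < w a" using a(1) nonneg(2)[of a] by linarith
  have ge: "w' b \<le> w b" if b: "k \<in> indices b" for b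
  proof (rule ccontr)
    assume "\<not> w' b \<le> w b"
    then have "w b < w' b" by simp
    moreover from this have "0 < w' b" using nonneg(1)[of b] by linarith
    then have "incidence_sign (var_edge b) k = incidence_sign (var_edge a) k"
      using same_point_sign[OF same _ _ b a(2)] a_pos by blast
    ultimately show False using no[OF b] by blast
  qed
  define \<sigma> :: real where "\<sigma> = (if incidence_sign (var_edge a) k = Pos then 1 else - 1)"
  have \<sigma>: "0 < \<sigma> * edge_form b (unit k)" if b: "k \<in> indices b" "0 < w b" for b
  proof -
    have "incidence_sign (var_edge b) k = incidence_sign (var_edge a) k"
      using same_point_sign[OF same _ _ b(1) a(2)] a_pos b(2) by blast
    then show ?thesis
      using edge_form_unit(2,3)[OF same_point_letters[OF same] b(1)] b(2)
      unfolding \<sigma>_def by (cases "incidence_sign (var_edge a) k") auto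
  qed
  have terms: "0 \<le> (w b - w' b) * (\<sigma> * edge_form b (unit k))" if "b \<in> letters n" for b
  proof (cases "k \<in> indices b \<and> 0 < w b")
    case True
    then show ?thesis using \<sigma>[of b] ge[of b] by (simp add: mult_nonneg_nonneg)
  next
    case False
    then have "k \<notin> indices b \<or> w b = 0 \<and> w' b = 0"
      using ge[of b] nonneg[of b] by force
    then show ?thesis using edge_form_unit(1)[OF that] by auto
  qed
  have "0 < (\<Sum>b\<in>letters n. (w b - w' b) * (\<sigma> * edge_form b (unit k)))"
  proof (rule sum_pos2)
    show "a \<in> letters n" using same_point_letters[OF same] a_pos by blast
    show "0 < (w a - w' a) * (\<sigma> * edge_form a (unit k))"
      using \<sigma>[OF a(2) a_pos] a(1) by simp
  qed (use finite_letters terms in auto)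
  also have "\<dots> = \<sigma> * (comb (letters n) w (unit k) - comb (letters n) w' (unit k))"
    by (simp add: comb_def sum_subtractf[symmetric] sum_distrib_left algebra_simps)
  also have "\<dots> = 0" using same by (simp add: same_point_def)
  finally show False by simp
qed

lemma same_point_compatible:
  assumes "same_point n w w'" "w a < w' a" "w b < w' b" "a \<noteq> b"
  shows "precedes a b \<or> precedes b a"
proof -
  have "0 < w' a" "0 < w' b" using assms(1-3) unfolding same_point_def by (meson le_less_trans)+
  then show ?thesis using assms(1,4) unfolding same_point_def canonical_def by blast
qed

text \<open>An excess at \<open>X i j\<close> is compensated at \<open>j\<close> by a longer edge
  \<open>b\<close> and at \<open>i\<close> by a letter \<open>c\<close>. But \<open>c\<close> starts
  or ends strictly inside \<open>b\<close>, so compatibility leaves only a shorter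
  \<open>X i l\<close>, on which the weights already agree.\<close>

lemma same_point_X_le:
  assumes same: "same_point n w w'"
    and shorter: "\<And>k l. k < l \<Longrightarrow> l - k < j - i \<Longrightarrow> w (X k l) = w' (X k l)"
  shows "w (X i j) \<le> w' (X i j)"
proof (rule ccontr)
  assume "\<not> ?thesis"
  then have excess: "w' (X i j) < w (X i j)" by simp
  have nonneg: "0 \<le> w b" "0 \<le> w' b" for b using same by (auto simp: same_point_def)
  have letter: "b \<in> letters n" if "w b < w' b \<or> w' b < w b" for b
    using same_point_letters[OF same, of b] that nonneg[of b] by linarith
  have ij: "i < j" using letter[of "X i j"] excess by simp
  obtain b where b: "j \<in> indices b" "w b < w' b" "incidence_sign (var_edge b) j = Neg"
    using exchange[OF same excess, of j] by auto
  then obtain i' where i': "b = X i' j" by (cases b) (auto split: if_splits)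
  have "i' < j" using letter[of b] b i' by simp
  moreover have "i' \<noteq> i" using b i' excess by auto
  moreover have "\<not> i < i'" using shorter[of i' j] b i' \<open>i' < j\<close> by (auto simp: diff_less_mono2)
  ultimately have "i' < i" by simp
  obtain c where c: "i \<in> indices c" "w c < w' c" "incidence_sign (var_edge c) i = Pos"
    using exchange[OF same excess, of i] ij by auto
  have "c \<noteq> b" using c(1) i' \<open>i' < i\<close> ij by auto
  then have compat: "precedes b c \<or> precedes c b"
    using same_point_compatible[OF same] b(2) c(2) by blast
  have c_letter: "c \<in> letters n" using letter c(2) by blast
  show False
  proof (cases c)
    case (X k l)
    then have "k = i" "i < l" using c c_letter by (auto split: if_splits)
    moreover from this have "l < j" using compat excess X i' c(2) \<open>i' < i\<close> ij
      by (cases "l = j") auto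
    ultimately show False using shorter[of i l] c(2) X by (auto simp: diff_less_mono)
  qed (use c c_letter compat i' \<open>i' < i\<close> ij in auto)
qed

lemma same_point_X: "same_point n w w' \<Longrightarrow> w (X i j) = w' (X i j)"
proof (induction "j - i" arbitrary: i j rule: less_induct)
  case less
  show ?case
  proof (rule antisym)
    show "w (X i j) \<le> w' (X i j)"
      using less by (intro same_point_X_le) auto
    show "w' (X i j) \<le> w (X i j)"
      using less by (intro same_point_X_le[OF same_point_sym]) auto
  qed
qed

section \<open>Uniqueness of the weights of positive edges and loops\<close>

abbreviation posvar :: "nat \<Rightarrow> nat \<Rightarrow> ncvar" where
  "posvar i j \<equiv> edge_var (i, j, Pos)"

text \<open>Positive edges are nested, so the induction goes from the outermost edge inwards. The
  compensating edges at \<open>i\<close> and at \<open>j\<close> are no longer than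
  \<open>j - i\<close>.\<close>

lemma same_point_posvar_le:
  assumes same: "same_point n w w'" and ij: "i \<le> j"
    and longer: "\<And>k l. k \<le> l \<Longrightarrow> j - i < l - k \<Longrightarrow> w (posvar k l) = w' (posvar k l)"
  shows "w (posvar i j) \<le> w' (posvar i j)"
proof (rule ccontr)
  assume "\<not> ?thesis"
  then have excess: "w' (posvar i j) < w (posvar i j)" by simp
  have nonneg: "0 \<le> w b" "0 \<le> w' b" for b using same by (auto simp: same_point_def)
  have letter: "b \<in> letters n" if "w b < w' b" for b
    using same_point_letters[OF same, of b] that nonneg[of b] by linarith
  have ind: "i \<in> indices (posvar i j)" "j \<in> indices (posvar i j)" by auto
  obtain b where b: "i \<in> indices b" "w b < w' b" using exchange[OF same excess ind(1)] by blast
  obtain c where c: "j \<in> indices c" "w c < w' c" using exchange[OF same excess ind(2)] by blast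
  have form: "\<exists>k l. d = posvar k l \<and> k \<le> l \<and> l - k \<le> j - i" if d: "w d < w' d" for d
  proof (cases d)
    case (X k l)
    then show ?thesis using d same_point_X[OF same, of k l] by simp
  next
    case (Y k l)
    then have "k < l" using letter[OF d] by simp
    then have "d = posvar k l" "k \<le> l" using Y by auto
    moreover from this have "l - k \<le> j - i" using longer[of k l] d by force
    ultimately show ?thesis by blast
  next
    case (Z k)
    then show ?thesis by (intro exI[of _ k]) auto
  qed
  obtain k l where kl: "b = posvar k l" "k \<le> l" "l - k \<le> j - i" using form[OF b(2)] by blast
  obtain k' l' where kl': "c = posvar k' l'" "k' \<le> l'" "l' - k' \<le> j - i" using form[OF c(2)] by blast
  have i: "i = k \<or> i = l" using b(1) kl(1) by (auto split: if_splits)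
  have j: "j = k' \<or> j = l'" using c(1) kl'(1) by (auto split: if_splits)
  have neq: "(k, l) \<noteq> (i, j)" "(k', l') \<noteq> (i, j)" using b(2) c(2) kl(1) kl'(1) excess by auto
  have "i < j"
    using kl i neq(1) ij by (cases "i = j") auto
  \<comment> \<open>Both ends of \<open>b\<close> lie strictly to the left of the corresponding ends
    of \<open>c\<close>, so neither interval contains the other and the two letters are not
    comparable.\<close>
  have bounds: "k \<le> i" "l < j" "i < k'" "j \<le> l'"
    using kl(2,3) kl'(2,3) i j neq \<open>i < j\<close> by auto
  then have "b \<noteq> c" using kl(1) kl'(1) \<open>i < j\<close> by (auto split: if_splits)
  then have "precedes b c \<or> precedes c b" using same_point_compatible[OF same b(2) c(2)] by blast
  then show False
    unfolding kl(1) kl'(1) using bounds \<open>i < j\<close> by (cases "k = l"; cases "k' = l'") auto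
qed

lemma same_point_posvar:
  assumes same: "same_point n w w'"
  shows "i \<le> j \<Longrightarrow> w (posvar i j) = w' (posvar i j)"
proof (induction "n - (j - i)" arbitrary: i j rule: less_induct)
  case less
  have longer: "w (posvar k l) = w' (posvar k l)" if kl: "k \<le> l" "j - i < l - k" for k l
  \<comment> \<open>The measure decreases only as long as the length stays within \<open>n\<close>;
    edges that leave the vertex set have weight zero on both sides.\<close>
  proof (cases "l \<le> n")
    case True
    then show ?thesis using less.hyps[OF _ kl(1)] kl(2) by (metis diff_le_self diff_less_mono2 le_less_trans less_le_trans)
  next
    case False
    then have "posvar k l \<notin> letters n" by auto
    then have "\<not> 0 < w (posvar k l)" "\<not> 0 < w' (posvar k l)"
      using same_point_letters[OF same] by blast+
    moreover have "0 \<le> w (posvar k l)" "0 \<le> w' (posvar k l)"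
      using same by (simp_all add: same_point_def)
    ultimately show ?thesis by linarith
  qed
  show ?case
  proof (rule antisym)
    show "w (posvar i j) \<le> w' (posvar i j)"
      by (rule same_point_posvar_le[OF same less.prems longer])
    show "w' (posvar i j) \<le> w (posvar i j)"
      by (rule same_point_posvar_le[OF same_point_sym[OF same] less.prems longer[symmetric]])
  qed
qed

lemma same_point_unique:
  assumes same: "same_point n w w'"
  shows "w = w'"
proof
  fix a
  have nonneg: "0 \<le> w a" "0 \<le> w' a" using same by (auto simp: same_point_def)
  show "w a = w' a"
  proof (cases a)
    case (X i j)
    then show ?thesis using same_point_X[OF same] by simp
  next
    case (Y i j)
    show ?thesis
    proof (cases "i < j")
      case True
      then show ?thesis using same_point_posvar[OF same, of i j] Y by simp
    next
      case False
      then have "a \<notin> letters n" using Y by simp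
      then show ?thesis using same_point_letters[OF same, of a] nonneg by linarith
    qed
  next
    case (Z i)
    then show ?thesis using same_point_posvar[OF same, of i i] by simp
  qed
qed

lemma canonical_unique:
  assumes "canonical n A" "canonical n B" "in_cone q A" "in_cone q B"
  shows "A = B"
proof -
  obtain w where w: "\<forall>a\<in>A. 0 < w a" "q = comb A w" using assms(3) unfolding in_cone_def by blast
  obtain w' where w': "\<forall>a\<in>B. 0 < w' a" "q = comb B w'" using assms(4) unfolding in_cone_def by blast
  define W where "W = (\<lambda>a. if a \<in> A then w a else 0)"
  define W' where "W' = (\<lambda>a. if a \<in> B then w' a else 0)"
  have "comb (letters n) W = comb A w"
    unfolding comb_def W_def using assms(1) finite_letters
    by (intro ext sum.mono_neutral_cong_right) (auto simp: canonical_def)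
  moreover have "comb (letters n) W' = comb B w'"
    unfolding comb_def W'_def using assms(2) finite_letters
    by (intro ext sum.mono_neutral_cong_right) (auto simp: canonical_def)
  moreover have supp: "{a. 0 < W a} = A" "{a. 0 < W' a} = B"
    using w(1) w'(1) by (auto simp: W_def W'_def)
  moreover have "0 \<le> W a \<and> 0 \<le> W' a" for a
    using w(1) w'(1) by (auto simp: W_def W'_def less_imp_le)
  ultimately have "same_point n W W'"
    using assms(1,2) w(2) w'(2) unfolding same_point_def by simp
  then have "W = W'" by (rule same_point_unique)
  then show ?thesis using supp by simp
qed

section \<open>Alternating well-structured graphs\<close>

definition admissible :: "nat \<Rightarrow> edge list \<Rightarrow> bool" where
  "admissible n T \<longleftrightarrow> signed_graph n (mset T) \<and> alternating (mset T) \<and>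
     well_structured n (mset T) \<and> lexicographic T"

lemma indices_edge_var: "indices (edge_var (i, j, s)) = {i, j}"
  by (cases s) auto

lemma incident_iff: "incident e v \<longleftrightarrow> v \<in> indices (edge_var e)"
  by (cases e) (auto simp: indices_edge_var simp del: edge_var.simps)

lemma joins_iff: "joins e u v \<longleftrightarrow> indices (edge_var e) = {u, v}"
  by (cases e) (auto simp: indices_edge_var doubleton_eq_iff simp del: edge_var.simps)

lemma linked_edge_var: "linked (edge_var ` set T) = adjacent (mset T)"
  by (intro ext) (auto simp: linked_def adjacent_def joins_iff)

section \<open>Lexicographic labelings and repeated edges\<close>

lemma not_distinct_iff: "\<not> distinct xs \<longleftrightarrow> (\<exists>x. {#x, x#} \<subseteq># mset xs)"
proof
  assume "\<not> distinct xs"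
  then obtain us vs ws x where "xs = us @ [x] @ vs @ [x] @ ws" using not_distinct_decomp by blast
  then have "{#x, x#} \<subseteq># mset xs" by (auto simp: mset_subset_eq_exists_conv)
  then show "\<exists>x. {#x, x#} \<subseteq># mset xs" by blast
next
  assume "\<exists>x. {#x, x#} \<subseteq># mset xs"
  then obtain x where x: "{#x, x#} \<subseteq># mset xs" by blast
  then have "2 \<le> count (mset xs) x" using mset_subset_eq_count[OF x, of x] by simp
  moreover have "count (mset xs) x \<le> 1" if "distinct xs"
    using that unfolding distinct_count_atmost_1 by (cases "x \<in> set xs") auto
  ultimately show "\<not> distinct xs" by linarith
qed

lemma lex_less_total: "e \<noteq> f \<Longrightarrow> lex_less e f \<or> lex_less f e"
proof -
  obtain i j s k l t where "e = (i, j, s)" "f = (k, l, t)" by (cases e; cases f)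
  then show "e \<noteq> f \<Longrightarrow> lex_less e f \<or> lex_less f e"
    by (cases s; cases t) auto
qed

lemma lex_less_asym: "lex_less e f \<Longrightarrow> \<not> lex_less f e"
  by (cases e; cases f) auto

lemma lex_less_trans: "lex_less e f \<Longrightarrow> lex_less f g \<Longrightarrow> lex_less e g"
  by (cases e; cases f; cases g) auto

text \<open>\<open>lexicographic\<close> puts no condition on equal edges; distinctness is what
  separates it from strict sortedness.\<close>

lemma sorted_wrt_lex_less_iff: "sorted_wrt lex_less T \<longleftrightarrow> distinct T \<and> lexicographic T"
proof
  assume T: "sorted_wrt lex_less T"
  then have "distinct T"
    by (induction T) (auto dest: lex_less_asym simp del: lex_less.simps)
  moreover have "lexicographic T"
    unfolding lexicographic_def
  proof (intro allI impI)
    fix a b assume "a < length T" "b < length T" "lex_less (T ! a) (T ! b)"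
    then show "a < b"
      using T lex_less_asym unfolding sorted_wrt_iff_nth_less by (metis linorder_neqE_nat)
  qed
  ultimately show "distinct T \<and> lexicographic T" ..
next
  assume T: "distinct T \<and> lexicographic T"
  show "sorted_wrt lex_less T"
    unfolding sorted_wrt_iff_nth_less
  proof (intro allI impI)
    fix a b assume ab: "a < b" "b < length T"
    then have "T ! a \<noteq> T ! b" using T by (simp add: nth_eq_iff_index_eq)
    moreover have "\<not> lex_less (T ! b) (T ! a)"
      using T ab unfolding lexicographic_def by (meson less_asym less_trans)
    ultimately show "lex_less (T ! a) (T ! b)" using lex_less_total by blast
  qed
qed

lemma sorted_wrt_unique:
  assumes "\<And>x y. r x y \<Longrightarrow> \<not> r y x"
  shows "sorted_wrt r xs \<Longrightarrow> sorted_wrt r ys \<Longrightarrow> set xs = set ys \<Longrightarrow> xs = ys"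
proof (induction xs arbitrary: ys)
  case Nil
  then show ?case by simp
next
  case (Cons x xs)
  then obtain y zs where ys: "ys = y # zs" by (cases ys) auto
  have "x = y"
  proof (rule ccontr)
    assume "x \<noteq> y"
    then have "r x y" "r y x" using Cons.prems ys by auto
    then show False using assms by blast
  qed
  moreover have "x \<notin> set xs" "y \<notin> set zs" using Cons.prems(1,2) assms ys by auto
  ultimately have "set xs = set zs" using Cons.prems(3) ys by auto
  then show ?case using Cons ys \<open>x = y\<close> by simp
qed

text \<open>A repeated nonloop edge is a cycle of length two, and a repeated loop gives two
  loops.\<close>

lemma well_structured_distinct:
  assumes "well_structured n (mset T)"
  shows "distinct T"
proof (rule ccontr)
  assume "\<not> distinct T"
  then obtain e where e: "{#e, e#} \<subseteq># mset T" unfolding not_distinct_iff by blast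
  obtain i j s where ijs: "e = (i, j, s)" by (cases e)
  show False
  proof (cases "i = j")
    case True
    then have "filter_mset is_loop {#e, e#} = {#e, e#}" by (simp add: is_loop_def ijs)
    then have "{#e, e#} \<subseteq># filter_mset is_loop (mset T)"
      using multiset_filter_mono[OF e, of is_loop] by simp
    then have "2 \<le> size (filter_mset is_loop (mset T))" using size_mset_mono by fastforce
    then show False using assms by (simp add: well_structured_def)
  next
    case False
    have "nonloop_cycle (mset T) [i, j] [e, e]"
      using e False unfolding nonloop_cycle_def
      by (auto simp: ijs less_Suc_eq)
    then show False using assms unfolding well_structured_def by blast
  qed
qed

text \<open>Each pair of letter kinds has its conditions: two \<open>X\<close> (i), \<open>X\<close>
  and \<open>Y\<close> (i) and (v), \<open>X\<close> and \<open>Z\<close> (iv), two \<open>Y\<close>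
  (i) and (ii), \<open>Y\<close> and \<open>Z\<close> (iii), two \<open>Z\<close> the single loop of
  (vi).\<close>

lemma admissible_canonical:
  assumes "admissible n T"
  shows "canonical n (edge_var ` set T)"
proof -
  let ?A = "edge_var ` set T"
  have sg: "signed_graph n (mset T)" and alt: "alternating (mset T)"
    and ws: "well_structured n (mset T)"
    using assms by (auto simp: admissible_def)
  note inverse = var_edge_edge_var[OF sg]
  have sub: "?A \<subseteq> letters n" using inverse(2) by auto
  have mem: "var_edge a \<in># mset T" if "a \<in> ?A" for a using that inverse(1) by auto
  have "noncrossing (mset T)" using ws by (simp add: well_structured_def)
  then have noncrossing: "\<not> (i < j \<and> j < k \<and> k < l)"
    if "(i, k, s) \<in># mset T" "(j, l, t) \<in># mset T" for i j k l s t
    using that unfolding noncrossing_def by metis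
  have ii: "i < l \<and> k < j"
    if "(i, j, Pos) \<in># mset T" "(k, l, Pos) \<in># mset T" "i < j" "k < l" for i j k l
    using ws that unfolding well_structured_def by blast
  have iii: "k \<le> i \<and> i \<le> l"
    if "(i, i, Pos) \<in># mset T" "(k, l, Pos) \<in># mset T" "k < l" for i k l
    using ws that unfolding well_structured_def by blast
  have iv: "\<not> (k < i \<and> i < j)"
    if "(i, i, Pos) \<in># mset T" "(k, j, Neg) \<in># mset T" for i j k
    using ws that unfolding well_structured_def by blast
  have v: "\<not> (k \<le> i \<and> i < j \<and> j \<le> l)"
    if "(i, j, Pos) \<in># mset T" "(k, l, Neg) \<in># mset T" for i j k l
    using ws that unfolding well_structured_def by blast
  have loops: "i = k" if "(i, i, Pos) \<in># mset T" "(k, k, Pos) \<in># mset T" for i k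
  proof -
    have "size (filter_mset is_loop (mset T)) = 1" using ws by (simp add: well_structured_def)
    then obtain e where e: "filter_mset is_loop (mset T) = {#e#}"
      using size_1_singleton_mset by blast
    have "(i, i, Pos) \<in># filter_mset is_loop (mset T)" "(k, k, Pos) \<in># filter_mset is_loop (mset T)"
      using that by (simp_all add: is_loop_def)
    then show ?thesis unfolding e by auto
  qed
  have "precedes a b \<or> precedes b a" if ab: "a \<in> ?A" "b \<in> ?A" "a \<noteq> b" for a b
  proof -
    have l: "a \<in> letters n" "b \<in> letters n" using ab sub by auto
    show ?thesis
    proof (cases a)
      case a: (X i j)
      note a' = mem[OF ab(1), unfolded a var_edge.simps]
      show ?thesis
      proof (cases b)
        case b: (X k l)
        note b' = mem[OF ab(2), unfolded b var_edge.simps]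
        show ?thesis using noncrossing[OF a' b'] noncrossing[OF b' a'] l ab(3)
          unfolding a b by simp linarith
      next
        case b: (Y k l)
        note b' = mem[OF ab(2), unfolded b var_edge.simps]
        show ?thesis using noncrossing[OF a' b'] noncrossing[OF b' a'] v[OF b' a'] l
          unfolding a b by simp linarith
      next
        case b: (Z k)
        note b' = mem[OF ab(2), unfolded b var_edge.simps]
        show ?thesis using iv[OF b' a'] l unfolding a b by simp linarith
      qed
    next
      case a: (Y i j)
      note a' = mem[OF ab(1), unfolded a var_edge.simps]
      show ?thesis
      proof (cases b)
        case b: (X k l)
        note b' = mem[OF ab(2), unfolded b var_edge.simps]
        show ?thesis using noncrossing[OF a' b'] noncrossing[OF b' a'] v[OF a' b'] l
          unfolding a b by simp linarith
      next
        case b: (Y k l)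
        note b' = mem[OF ab(2), unfolded b var_edge.simps]
        show ?thesis using noncrossing[OF a' b'] noncrossing[OF b' a'] ii[OF a' b'] l ab(3)
          unfolding a b by simp linarith
      next
        case b: (Z k)
        note b' = mem[OF ab(2), unfolded b var_edge.simps]
        show ?thesis using iii[OF b' a'] l unfolding a b by simp linarith
      qed
    next
      case a: (Z i)
      note a' = mem[OF ab(1), unfolded a var_edge.simps]
      show ?thesis
      proof (cases b)
        case b: (X k l)
        note b' = mem[OF ab(2), unfolded b var_edge.simps]
        show ?thesis using iv[OF a' b'] l unfolding a b by simp linarith
      next
        case b: (Y k l)
        note b' = mem[OF ab(2), unfolded b var_edge.simps]
        show ?thesis using iii[OF a' b'] l unfolding a b by simp linarith
      next
        case b: (Z k)
        note b' = mem[OF ab(2), unfolded b var_edge.simps]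
        show ?thesis using loops[OF a' b'] ab(3) unfolding a b by simp
      qed
    qed
  qed
  moreover have "\<not> clash v a b" if "a \<in> ?A" "b \<in> ?A" for v a b
    using alt mem[OF that(1)] mem[OF that(2)] that sub edge_var_var_edge
    unfolding clash_def alternating_def incident_iff by (metis subsetD)
  ultimately show ?thesis using sub unfolding canonical_def by blast
qed

lemma admissible_spanning:
  assumes "admissible n T"
  shows "spanning n (edge_var ` set T)" and "\<exists>i. Z i \<in> edge_var ` set T"
proof -
  have sg: "signed_graph n (mset T)" and ws: "well_structured n (mset T)"
    using assms by (auto simp: admissible_def)
  show "spanning n (edge_var ` set T)"
    using ws unfolding spanning_def linked_edge_var well_structured_def connected_graph_def by blast
  have "size (filter_mset is_loop (mset T)) = 1" using ws by (simp add: well_structured_def)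
  then obtain e where e: "filter_mset is_loop (mset T) = {#e#}" using size_1_singleton_mset by blast
  then have "e \<in># filter_mset is_loop (mset T)" by simp
  then have "e \<in># mset T" "is_loop e" by auto
  moreover obtain i j s where "e = (i, j, s)" by (cases e)
  ultimately have ijs: "(i, i, s) \<in># mset T" by (simp add: is_loop_def)
  then have "s = Pos" using sg unfolding signed_graph_def by blast
  with ijs have "Z i \<in> edge_var ` set T" by (intro image_eqI[of _ _ "(i, i, Pos)"]) auto
  then show "\<exists>i. Z i \<in> edge_var ` set T" ..
qed

lemma admissible_sorted: "admissible n T \<Longrightarrow> sorted_wrt lex_less T"
  unfolding admissible_def sorted_wrt_lex_less_iff using well_structured_distinct by blast

lemma admissible_inj:
  assumes "admissible n T" "admissible n T'" "edge_var ` set T = edge_var ` set T'"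
  shows "T = T'"
proof -
  have "var_edge ` edge_var ` set S = set S" if "admissible n S" for S
    using that var_edge_edge_var(1) unfolding admissible_def
    by (force simp: image_image)
  then have "set T = set T'" using assms by metis
  then show ?thesis
    using sorted_wrt_unique[of lex_less T T'] lex_less_asym assms(1,2) admissible_sorted by blast
qed

text \<open>Gives the right-hand side of the theorem its meaning, since a sum over an infinite set
  is 0 by convention.\<close>

lemma finite_admissible: "finite {T. admissible n T}"
proof (rule finite_subset)
  show "{T. admissible n T} \<subseteq> {T. set T \<subseteq> var_edge ` letters n \<and> distinct T}"
  proof (intro subsetI CollectI conjI)
    fix T e assume T: "T \<in> {T. admissible n T}"
    show "distinct T" using T well_structured_distinct by (auto simp: admissible_def)
    assume "e \<in> set T"
    then have "edge_var e \<in> letters n" "var_edge (edge_var e) = e"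
      using T var_edge_edge_var[of n "mset T" e] by (simp_all add: admissible_def)
    then show "e \<in> var_edge ` letters n" by (metis imageI)
  qed
  show "finite {T. set T \<subseteq> var_edge ` letters n \<and> distinct T}"
    by (intro finite_subset_distinct finite_imageI finite_letters)
qed

section \<open>Irreducible good monomials and admissible graphs\<close>

abbreviation lex_letter :: "ncvar \<Rightarrow> ncvar \<Rightarrow> bool" where
  "lex_letter a b \<equiv> lex_less (var_edge a) (var_edge b)"

text \<open>Where two letters of an alternating graph share a vertex, the order forced by the rules
  is the lexicographic one. Hence commutations suffice to sort.\<close>

lemma precedes_lex:
  assumes "precedes a b" "a \<in> letters n" "b \<in> letters n" "\<And>v. \<not> clash v a b"
  shows "lex_letter a b \<or> indices a \<inter> indices b = {}"
proof (rule ccontr)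
  assume no: "\<not> ?thesis"
  then obtain v where "v \<in> indices a" "v \<in> indices b" by blast
  moreover from this have "incidence_sign (var_edge a) v = incidence_sign (var_edge b) v"
    using assms(4)[of v] by (simp add: clash_def)
  ultimately show False
    using no assms(1-3) by (cases a; cases b) (auto split: if_splits)
qed

text \<open>Insertion sort: \<open>a\<close> moves to the right past letters that are smaller than
  it, all of which are disjoint from it.\<close>

lemma word_insert_sorted:
  assumes "sorted_wrt lex_letter V" "\<forall>b\<in>set V. lex_letter a b \<or> indices a \<inter> indices b = {}"
    "\<forall>b\<in>set V. var_edge a \<noteq> var_edge b"
  shows "\<exists>W. word W = word (a # V) \<and> mset W = mset (a # V) \<and> sorted_wrt lex_letter W"
  using assms
proof (induction V)
  case Nil
  then show ?case by (intro exI[of _ "[a]"]) simp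
next
  case (Cons b V)
  show ?case
  proof (cases "lex_letter a b")
    case True
    then have "sorted_wrt lex_letter (a # b # V)"
      using Cons.prems(1) lex_less_trans by auto
    then show ?thesis by blast
  next
    case False
    then have disjoint: "indices a \<inter> indices b = {}" and ba: "lex_letter b a"
      using Cons.prems(2,3) False lex_less_total[of "var_edge a" "var_edge b"] by auto
    obtain W where W: "word W = word (a # V)" "mset W = mset (a # V)" "sorted_wrt lex_letter W"
      using Cons by auto
    have "word (b # W) = word (b # a # V)"
      unfolding word_Cons[of b W] word_Cons[of b "a # V"] W(1) ..
    then have "word (b # W) = word (a # b # V)" using word_swap[OF disjoint] by simp
    moreover have "set W = insert a (set V)" using W(2) by (metis list.simps(15) set_mset_mset)
    then have "sorted_wrt lex_letter (b # W)" using W(3) ba Cons.prems(1) by auto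
    moreover have "mset (b # W) = mset (a # b # V)" using W(2) by simp
    ultimately show ?thesis by blast
  qed
qed

lemma word_sort:
  assumes "sorted_wrt (\<lambda>a b. lex_letter a b \<or> indices a \<inter> indices b = {}) U"
    "distinct (map var_edge U)"
  shows "\<exists>W. word W = word U \<and> mset W = mset U \<and> sorted_wrt lex_letter W"
  using assms
proof (induction U)
  case Nil
  show ?case by (intro exI[of _ "[]"]) simp
next
  case (Cons a U)
  then obtain V where V: "word V = word U" "mset V = mset U" "sorted_wrt lex_letter V" by auto
  have set: "set V = set U" using V(2) by (metis set_mset_mset)
  obtain W where W: "word W = word (a # V)" "mset W = mset (a # V)" "sorted_wrt lex_letter W"
  proof -
    have "\<forall>b\<in>set V. lex_letter a b \<or> indices a \<inter> indices b = {}"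
      "\<forall>b\<in>set V. var_edge a \<noteq> var_edge b"
      using Cons.prems unfolding set by auto
    then show ?thesis using word_insert_sorted[OF V(3)] that by blast
  qed
  have "word (a # V) = word (a # U)"
    unfolding word_Cons[of a V] word_Cons[of a U] V(1) ..
  then show ?case using W V(2) by auto
qed

lemma no_nonloop_cycle:
  assumes "spanning n (edge_var ` set T)" "Z i \<in> edge_var ` set T" "edge_var ` set T \<subseteq> letters n"
    and "length T = n" "distinct T" "inj_on edge_var (set T)"
  shows "\<not> nonloop_cycle (mset T) vs es"
proof
  assume "nonloop_cycle (mset T) vs es"
  then have len: "2 \<le> length vs" "length es = length vs" and vs: "distinct vs"
    and sub: "mset es \<subseteq># mset T"
    and joins: "\<And>a. a < length vs \<Longrightarrow> joins (es ! a) (vs ! a) (vs ! (Suc a mod length vs))"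
    by (auto simp: nonloop_cycle_def)
  let ?A = "edge_var ` set T"
  have es: "distinct es"
    using sub assms(5) not_distinct_iff subset_mset.order_trans by metis
  have set_es: "set es \<subseteq> set T" using set_mset_mono[OF sub] by simp
  have card: "card ?A = n" using assms(4-6) by (simp add: card_image distinct_card)
  define m where "m = length vs - 1"
  have "Suc m = length vs" using len by (simp add: m_def)
  then have m: "m < length vs" "0 < m" "Suc m mod length vs = 0" using len by auto
  \<comment> \<open>The closing edge of the cycle; the other edges form a path between its ends that
    avoids it.\<close>
  define e where "e = edge_var (es ! m)"
  have e: "e \<in> ?A" using set_es m(1) len(2) unfolding e_def by (metis image_eqI nth_mem subsetD)
  have "(linked (?A - {e}))\<^sup>*\<^sup>* (vs ! 0) (vs ! k)" if "k \<le> m" for k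
    using that
  proof (induction k)
    case 0
    show ?case by simp
  next
    case (Suc k)
    have k: "k < length vs" "Suc k mod length vs = Suc k" using Suc.prems m len by auto
    have "es ! k \<noteq> es ! m"
      using es k(1) m(1) len Suc.prems by (simp add: nth_eq_iff_index_eq)
    moreover have mem: "es ! k \<in> set T" "es ! m \<in> set T"
      using set_es k(1) m(1) len(2) by (metis nth_mem subsetD)+
    ultimately have "edge_var (es ! k) \<noteq> e"
      using assms(6) unfolding e_def by (meson inj_onD)
    then have "edge_var (es ! k) \<in> ?A - {e}" using mem by blast
    moreover have "indices (edge_var (es ! k)) = {vs ! k, vs ! Suc k}"
      using joins[OF k(1)] k(2) by (simp add: joins_iff)
    ultimately have "(linked (?A - {e}))\<^sup>*\<^sup>* (vs ! k) (vs ! Suc k)" by (rule linked_edge)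
    with Suc show ?case by (meson Suc_leD rtranclp_trans)
  qed
  then have "(linked (?A - {e}))\<^sup>*\<^sup>* (vs ! m) (vs ! 0)" using linked_rtranclp_sym by blast
  moreover have "indices e = {vs ! m, vs ! 0}"
    using joins[OF m(1)] m(3) by (simp add: joins_iff e_def)
  moreover have "vs ! m \<noteq> vs ! 0"
    using nth_eq_iff_index_eq[OF vs m(1), of 0] m(1,2) by linarith
  ultimately show False using spanning_no_cycle[OF assms(1-3) card e] by blast
qed

text \<open>Sorting uses commutations only, so the labeled graph represents the same monomial.
  Comparability of all pairs of letters returns (i) to (v), and the edge count excludes
  cycles.\<close>

lemma good_no_clash_admissible:
  assumes good: "good n U" and no_clash: "\<And>v a b. a \<in> set U \<Longrightarrow> b \<in> set U \<Longrightarrow> \<not> clash v a b"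
  shows "\<exists>T. admissible n T \<and> word U = word (map edge_var T)"
proof -
  have sub: "set U \<subseteq> letters n" and len: "length U = n" and sorted: "sorted_wrt precedes U"
    and sp: "spanning n (set U)" and one: "\<exists>!i. Z i \<in> set U"
    using good by (auto simp: good_def)
  note inverse = edge_var_var_edge[OF subsetD[OF sub]]
  have inj: "inj_on var_edge (set U)" using inverse by (rule inj_on_inverseI)
  have "sorted_wrt (\<lambda>a b. lex_letter a b \<or> indices a \<inter> indices b = {}) U"
    using sorted
  proof (rule sorted_wrt_mono_rel[rotated])
    fix a b assume "a \<in> set U" "b \<in> set U" "precedes a b"
    then show "lex_letter a b \<or> indices a \<inter> indices b = {}"
      using precedes_lex[of a b n] sub no_clash by blast
  qed
  moreover have "distinct (map var_edge U)"
    using good_distinct[OF good] inj by (simp add: distinct_map)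
  ultimately obtain W where W: "word W = word U" "mset W = mset U" "sorted_wrt lex_letter W"
    using word_sort by blast
  have set_W: "set W = set U" using W(2) by (metis set_mset_mset)
  define T where "T = map var_edge W"
  have edge_var_T: "map edge_var T = W"
    unfolding T_def map_map by (rule map_idI) (simp add: set_W inverse)
  have image: "edge_var ` set T = set U"
    using edge_var_T set_W by (metis set_map)
  have lex: "sorted_wrt lex_less T" unfolding T_def sorted_wrt_map by (rule W(3))
  then have distinct: "distinct T" and "lexicographic T" using sorted_wrt_lex_less_iff by blast+
  have T_letter: "edge_var e \<in> set U \<and> var_edge (edge_var e) = e" if "e \<in> set T" for e
    using that set_W inverse unfolding T_def by auto
  have mem: "edge_var e \<in> set U \<and> edge_var e \<in> letters n" if "e \<in># mset T" for e
    using T_letter[of e] that sub by (simp add: subset_iff)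
  have loopT: "s = Pos" if "(i, i, s) \<in># mset T" for i s
    using mem[OF that] by (cases s) auto
  have signed: "signed_graph n (mset T)"
    unfolding signed_graph_def
  proof (intro allI impI)
    fix i j s assume e: "(i, j, s) \<in># mset T"
    then have "edge_var (i, j, s) \<in> letters n" using mem by blast
    moreover have "var_edge (edge_var (i, j, s)) = (i, j, s)" using e T_letter by simp
    ultimately show "1 \<le> i \<and> i \<le> j \<and> j \<le> n \<and> (i = j \<longrightarrow> s = Pos)"
      by (cases s) (auto split: if_splits)
  qed
  have alt: "alternating (mset T)"
    unfolding alternating_def
  proof (intro allI impI)
    fix v e f assume "e \<in># mset T \<and> f \<in># mset T \<and> incident e v \<and> incident f v"
    then show "incidence_sign e v = incidence_sign f v"
      using no_clash[of "edge_var e" "edge_var f" v] T_letter unfolding incident_iff clash_def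
      by (metis set_mset_mset)
  qed
  have pair: "a = b \<or> precedes a b \<or> precedes b a" if "a \<in> set U" "b \<in> set U" for a b
    using sorted that by (induction U) auto
  have pair_edges: "e = f \<or> precedes (edge_var e) (edge_var f) \<or> precedes (edge_var f) (edge_var e)"
    if "e \<in># mset T" "f \<in># mset T" for e f
    using pair T_letter that by (metis set_mset_mset)
  have "noncrossing (mset T)"
    unfolding noncrossing_def
  proof (intro notI, elim exE conjE)
    fix i j k l s t
    assume less: "i < j" "j < k" "k < l" and e: "(i, k, s) \<in># mset T" "(j, l, t) \<in># mset T"
    show False
      using pair_edges[OF e] less by (cases s; cases t) auto
  qed
  moreover have "i < l \<and> k < j"
    if "(i, j, Pos) \<in># mset T" "(k, l, Pos) \<in># mset T" "i < j" "k < l" for i j k l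
    using pair_edges[OF that(1,2)] that(3,4) by auto
  moreover have "k \<le> i \<and> i \<le> l"
    if "(i, i, Pos) \<in># mset T" "(k, l, Pos) \<in># mset T" "k < l" for i k l
    using pair_edges[OF that(1,2)] that(3) by auto
  moreover have "\<not> (k < i \<and> i < j)"
    if "(i, i, Pos) \<in># mset T" "(k, j, Neg) \<in># mset T" for i j k
    using pair_edges[OF that(1,2)] by auto
  moreover have "\<not> (k \<le> i \<and> i < j \<and> j \<le> l)"
    if "(i, j, Pos) \<in># mset T" "(k, l, Neg) \<in># mset T" for i j k l
    using pair_edges[OF that(1,2)] by auto
  moreover have "connected_graph n (mset T)"
    using sp unfolding connected_graph_def linked_edge_var[symmetric] image spanning_def .
  moreover have "size (filter_mset is_loop (mset T)) = 1"
  proof -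
    obtain i where i: "Z i \<in> set U" "\<And>k. Z k \<in> set U \<Longrightarrow> k = i" using one by blast
    have "set (filter is_loop T) = {(i, i, Pos)}"
    proof (intro equalityI subsetI)
      fix e assume "e \<in> set (filter is_loop T)"
      then have e: "e \<in> set T" "is_loop e" by auto
      obtain k l s where kls: "e = (k, l, s)" by (cases e)
      then have "e = (k, k, Pos)" using e loopT by (auto simp: is_loop_def)
      moreover from this have "Z k \<in> set U" using T_letter[OF e(1)] by simp
      ultimately show "e \<in> {(i, i, Pos)}" using i(2) by simp
    next
      fix e assume "e \<in> {(i, i, Pos)}"
      then have "e = var_edge (Z i)" by simp
      moreover from this have "e \<in> set T" using i(1) set_W unfolding T_def by (metis imageI set_map)
      ultimately show "e \<in> set (filter is_loop T)" by (simp add: is_loop_def)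
    qed
    then have "card (set (filter is_loop T)) = 1" by simp
    then have "length (filter is_loop T) = 1"
      using distinct by (metis distinct_card distinct_filter)
    then show ?thesis by (metis mset_filter size_mset)
  qed
  moreover have "\<not> (\<exists>vs es. nonloop_cycle (mset T) vs es)"
  proof -
    have "length T = n" unfolding T_def using W(2) len by (metis length_map size_mset)
    moreover have "inj_on edge_var (set T)"
      using T_letter by (intro inj_on_inverseI[of _ var_edge]) auto
    ultimately show ?thesis
      using no_nonloop_cycle[of n T] sp one sub distinct unfolding image by blast
  qed
  ultimately have "well_structured n (mset T)"
    unfolding well_structured_def by blast
  then have "admissible n T"
    unfolding admissible_def using signed alt \<open>lexicographic T\<close> by blast
  then show ?thesis using edge_var_T W(1) by metis
qed

theorem theorem21:
  fixes n :: nat and P :: ncpoly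
  assumes "1 \<le> n"
    and "reduced_form P (w_C n)"
  shows "P = (\<Sum>T | signed_graph n (mset T) \<and> alternating (mset T) \<and>
                   well_structured n (mset T) \<and> lexicographic T. m_B T)"
proof -
  have w_C: "w_C n = word (coxeter_letters n)" by (simp add: w_C_def coxeter_letters_def)
  have red: "reduces\<^sup>*\<^sup>* (Poly_Mapping.single (w_C n) 1) P" and irred: "\<not> (\<exists>Q. reduces P Q)"
    using assms(2) by (auto simp: reduced_form_def)
  have initial: "good_monomial n m" if "m \<in> Poly_Mapping.keys (Poly_Mapping.single (w_C n) (1::rat))" for m
    using that good_coxeter_letters[OF assms(1)] by (simp add: w_C good_monomial_word)
  let ?m = "\<lambda>T. word (map edge_var T)"
  let ?A = "\<lambda>T. edge_var ` set T"
  \<comment> \<open>Goodness does not depend on the point, but the lemma that preserves it is stated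
    together with the valuation and asks for one.\<close>
  obtain q\<^sub>0 where "generic n q\<^sub>0"
    using generic_point_exists[of "set (coxeter_letters n)" n] good_coxeter_letters[OF assms(1)]
    unfolding good_def by blast
  then have good: "good_monomial n m" if "m \<in> Poly_Mapping.keys P" for m
    using good_monomial_reduces_rtranclp[OF red initial] that by blast
  have keys: "\<exists>T. admissible n T \<and> m = ?m T" if m: "m \<in> Poly_Mapping.keys P" for m
  proof -
    obtain U where U: "m = word U" by (rule word_surj)
    have goodU: "good n U" using good[OF m] unfolding U good_monomial_word .
    have "word U \<noteq> p + l + r" if "reduction_rule l s" for p l r s
      using irred m reduces.intros[OF that _ refl] unfolding U by metis
    then show ?thesis
      using good_no_clash_admissible[OF goodU] good_irreducible_no_clash[OF goodU] U by blast
  qed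
  have same: "T = T'" if "admissible n T" "admissible n T'" "?m T = ?m T'" for T T'
  proof -
    have "mset (map edge_var T) = mset (map edge_var T')"
      using that(3) by (metis content_word)
    then have "?A T = ?A T'" by (metis set_map set_mset_mset)
    then show ?thesis using admissible_inj that(1,2) by blast
  qed
  have coefficient: "Poly_Mapping.lookup P (?m T) = 1" if T: "admissible n T" for T
  proof -
    have sub: "?A T \<subseteq> letters n" using admissible_canonical[OF T] by (simp add: canonical_def)
    obtain q where q: "generic n q" "in_cone q (?A T)"
      using generic_point_exists[OF sub] admissible_spanning[OF T] by blast
    have "1 = valuation q (Poly_Mapping.single (w_C n) 1)"
      using in_cone_coxeter[OF assms(1) q sub] by (simp add: valuation_single w_C)
    also have "\<dots> = valuation q P"
      using good_monomial_reduces_rtranclp[OF red initial q(1)] by simp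
    \<comment> \<open>The monomial of \<open>T\<close> is added to the range because it is not yet
      known to occur in \<open>P\<close>. All other terms vanish by disjointness of the cones, which
      isolates its coefficient.\<close>
    also have "\<dots> = (\<Sum>m\<in>insert (?m T) (Poly_Mapping.keys P).
        Poly_Mapping.lookup P m * of_bool (in_cone q (set_mset (content m))))"
      by (rule valuation_superset) auto
    also have "\<dots> = (\<Sum>m\<in>{?m T}. Poly_Mapping.lookup P m * of_bool (in_cone q (set_mset (content m))))"
    proof (rule sum.mono_neutral_right)
      show "\<forall>m\<in>insert (?m T) (Poly_Mapping.keys P) - {?m T}.
        Poly_Mapping.lookup P m * of_bool (in_cone q (set_mset (content m))) = 0"
      proof
        fix m assume m: "m \<in> insert (?m T) (Poly_Mapping.keys P) - {?m T}"
        then obtain T' where T': "admissible n T'" "m = ?m T'" using keys by blast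
        have "\<not> in_cone q (?A T')"
          using canonical_unique[OF admissible_canonical[OF T] admissible_canonical[OF T'(1)] q(2)]
            admissible_inj[OF T T'(1)] m T'(2) by blast
        then show "Poly_Mapping.lookup P m * of_bool (in_cone q (set_mset (content m))) = 0"
          by (simp add: T'(2))
      qed
    qed auto
    finally show ?thesis using q(2) by simp
  qed
  have "P = (\<Sum>T | admissible n T. m_B T)"
  proof (rule poly_mapping_eqI)
    fix m
    have "Poly_Mapping.lookup (\<Sum>T | admissible n T. m_B T) m
        = (\<Sum>T | admissible n T. if ?m T = m then 1 else 0)"
      by (simp add: lookup_sum m_B_def mono_poly_def lookup_single when_def)
    also have "\<dots> = Poly_Mapping.lookup P m"
    proof (cases "\<exists>T. admissible n T \<and> ?m T = m")
      case True
      then obtain T where T: "admissible n T" "?m T = m" by blast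
      have "(\<Sum>S | admissible n S. if ?m S = m then 1 else (0::rat))
          = (\<Sum>S | admissible n S. if S = T then 1 else 0)"
        using same T by (intro sum.cong) auto
      also have "\<dots> = 1" using T(1) finite_admissible by simp
      finally show ?thesis using coefficient T by metis
    next
      case False
      then have "Poly_Mapping.lookup P m = 0" using keys by (metis in_keys_iff)
      moreover have "(\<Sum>S | admissible n S. if ?m S = m then 1 else (0::rat)) = 0"
        using False by (intro sum.neutral) auto
      ultimately show ?thesis by simp
    qed
    finally show "Poly_Mapping.lookup P m = Poly_Mapping.lookup (\<Sum>T | admissible n T. m_B T) m" ..
  qed
  then show ?thesis unfolding admissible_def .
qed

end
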